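(* Let $1<p\le 2\le q<\infty$ with $p<q$, and let $T\colon\ell_p\to\ell_q$ be a Pełczyński Decomposition operator. Then $\mathcal J^T=\mathcal J^{\ell_2}$, that is, the closed ideal of $L(\ell_p,\ell_q)$ generated by $T$ coincides with the operator-norm closure of the set of all operators in $L(\ell_p,\ell_q)$ that factor through $\ell_2$.
   Context: $L(X,Y)$ is the space of bounded linear operators from $X$ to $Y$, and $L(X)=L(X,X)$. An ideal in $L(\ell_p,\ell_q)$ is a linear subspace $\mathcal J\subseteq L(\ell_p,\ell_q)$ such that $ATB\in\mathcal J$ whenever $A\in L(\ell_q)$, $T\in\mathcal J$, $B\in L(\ell_p)$; closed means closed in operator norm. $\mathcal J^T$ is the smallest closed ideal containing $T$. An operator $S\in L(\ell_p,\ell_q)$ factors through $\ell_2$ if $S=AB$ with $B\in L(\ell_p,\ell_2)$, $A\in L(\ell_2,\ell_q)$. For $1<r<\infty$, $\bigl(\bigoplus_{n=1}^\infty\ell_2^n\bigr)_r$ denotes the $\ell_r$-direct sum of the $\ell_2^n$; it is known to be isomorphic to $\ell_r$. Let $I_{2,p,q}\colon\bigl(\bigoplus_{n}\ell_2^n\bigr)_p\to\bigl(\bigoplus_{n}\ell_2^n\bigr)_q$ be the formal identity. A Pełczyński Decomposition operator is any operator $T=V I_{2,p,q}U\colon\ell_p\to\ell_q$, where $U\colon\ell_p\to\bigl(\bigoplus_{n}\ell_2^n\bigr)_p$ and $V\colon\bigl(\bigoplus_{n}\ell_2^n\bigr)_q\to\ell_q$ are (surjective) isomorphisms. *)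

theory Defs
  imports "HOL-Analysis.Analysis" "HOL-Library.Function_Algebras"
begin

text \<open>
  The exponents are real numbers, so the spaces cannot be types: a normed space is a carrier set of
  scalar families together with a norm, with pointwise vector operations (addition, subtraction and
  zero come from \<^theory>\<open>HOL-Library.Function_Algebras\<close>). The scalars are any complete
  \<^class>\<open>real_normed_field\<close>; by the Gelfand--Mazur theorem these are exactly the real and the
  complex numbers, so both cases are covered.
\<close>

record ('i, 'k) nspace =
  vecs :: "('i \<Rightarrow> 'k) set"
  nrm :: "('i \<Rightarrow> 'k) \<Rightarrow> real"

definition scl :: "'k::real_normed_field \<Rightarrow> ('i \<Rightarrow> 'k) \<Rightarrow> ('i \<Rightarrow> 'k)" where
  "scl c x = (\<lambda>i. c * x i)"

definition ell :: "real \<Rightarrow> (nat, 'k::real_normed_field) nspace" where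
  "ell p = \<lparr>vecs = {x. summable (\<lambda>n. norm (x n) powr p)},
            nrm = (\<lambda>x. (\<Sum>n. norm (x n) powr p) powr (1 / p))\<rparr>"

text \<open>Vectors of length \<open>n\<close> are sequences supported in \<open>{..<n}\<close>.\<close>

definition ell2_fin :: "nat \<Rightarrow> (nat, 'k::real_normed_field) nspace" where
  "ell2_fin n = \<lparr>vecs = {x. \<forall>i\<ge>n. x i = 0},
                 nrm = (\<lambda>x. L2_set (\<lambda>i. norm (x i)) {..<n})\<rparr>"

definition direct_sum ::
  "real \<Rightarrow> (nat \<Rightarrow> ('i, 'k) nspace) \<Rightarrow> (nat \<times> 'i, 'k::real_normed_field) nspace" where
  "direct_sum r X =
     \<lparr>vecs = {x. (\<forall>n. (\<lambda>i. x (n, i)) \<in> vecs (X n)) \<and>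
                 summable (\<lambda>n. nrm (X n) (\<lambda>i. x (n, i)) powr r)},
      nrm = (\<lambda>x. (\<Sum>n. nrm (X n) (\<lambda>i. x (n, i)) powr r) powr (1 / r))\<rparr>"

text \<open>The sum runs over the dimensions \<open>1, 2, 3, \<dots>\<close>, hence the \<^const>\<open>Suc\<close>.\<close>

definition ell2_sum :: "real \<Rightarrow> (nat \<times> nat, 'k::real_normed_field) nspace" where
  "ell2_sum r = direct_sum r (\<lambda>n. ell2_fin (Suc n))"

text \<open>
  The bounded linear operators from \<open>X\<close> to \<open>Y\<close>. To have a unique representative, an operator is
  extended by zero outside the carrier of \<open>X\<close>; this convention is stable under sums, scalar
  multiples and compositions of the representing functions.
\<close>

definition bounded_ops ::
  "('i, 'k::real_normed_field) nspace \<Rightarrow> ('j, 'k) nspace \<Rightarrow> (('i \<Rightarrow> 'k) \<Rightarrow> ('j \<Rightarrow> 'k)) set" where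
  "bounded_ops X Y = {T.
     (\<forall>x\<in>vecs X. T x \<in> vecs Y) \<and>
     (\<forall>x\<in>vecs X. \<forall>y\<in>vecs X. T (x + y) = T x + T y) \<and>
     (\<forall>c. \<forall>x\<in>vecs X. T (scl c x) = scl c (T x)) \<and>
     (\<exists>C. \<forall>x\<in>vecs X. nrm Y (T x) \<le> C * nrm X x) \<and>
     (\<forall>x. x \<notin> vecs X \<longrightarrow> T x = 0)}"

definition op_norm ::
  "('i, 'k::real_normed_field) nspace \<Rightarrow> ('j, 'k) nspace \<Rightarrow> (('i \<Rightarrow> 'k) \<Rightarrow> ('j \<Rightarrow> 'k)) \<Rightarrow> real" where
  "op_norm X Y T = (SUP x\<in>{x \<in> vecs X. nrm X x \<le> 1}. nrm Y (T x))"

definition op_closure ::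
  "('i, 'k::real_normed_field) nspace \<Rightarrow> ('j, 'k) nspace \<Rightarrow>
   (('i \<Rightarrow> 'k) \<Rightarrow> ('j \<Rightarrow> 'k)) set \<Rightarrow> (('i \<Rightarrow> 'k) \<Rightarrow> ('j \<Rightarrow> 'k)) set" where
  "op_closure X Y J =
     {S \<in> bounded_ops X Y. \<forall>e>0. \<exists>R\<in>J. op_norm X Y (S - R) < e}"

definition op_ideal ::
  "('i, 'k::real_normed_field) nspace \<Rightarrow> ('j, 'k) nspace \<Rightarrow>
   (('i \<Rightarrow> 'k) \<Rightarrow> ('j \<Rightarrow> 'k)) set \<Rightarrow> bool" where
  "op_ideal X Y J \<longleftrightarrow>
     J \<subseteq> bounded_ops X Y \<and>
     0 \<in> J \<and>
     (\<forall>S\<in>J. \<forall>T\<in>J. S + T \<in> J) \<and>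
     (\<forall>c. \<forall>T\<in>J. (\<lambda>x. scl c (T x)) \<in> J) \<and>
     (\<forall>A\<in>bounded_ops Y Y. \<forall>T\<in>J. \<forall>B\<in>bounded_ops X X. A \<circ> T \<circ> B \<in> J)"

definition closed_op_ideal ::
  "('i, 'k::real_normed_field) nspace \<Rightarrow> ('j, 'k) nspace \<Rightarrow>
   (('i \<Rightarrow> 'k) \<Rightarrow> ('j \<Rightarrow> 'k)) set \<Rightarrow> bool" where
  "closed_op_ideal X Y J \<longleftrightarrow> op_ideal X Y J \<and> op_closure X Y J = J"

definition generated_closed_ideal ::
  "('i, 'k::real_normed_field) nspace \<Rightarrow> ('j, 'k) nspace \<Rightarrow>
   (('i \<Rightarrow> 'k) \<Rightarrow> ('j \<Rightarrow> 'k)) \<Rightarrow> (('i \<Rightarrow> 'k) \<Rightarrow> ('j \<Rightarrow> 'k)) set" where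
  "generated_closed_ideal X Y T = \<Inter>{J. closed_op_ideal X Y J \<and> T \<in> J}"

definition factors_through_ell2 ::
  "('i, 'k::real_normed_field) nspace \<Rightarrow> ('j, 'k) nspace \<Rightarrow> (('i \<Rightarrow> 'k) \<Rightarrow> ('j \<Rightarrow> 'k)) \<Rightarrow> bool" where
  "factors_through_ell2 X Y S \<longleftrightarrow>
     (\<exists>B\<in>bounded_ops X (ell 2). \<exists>A\<in>bounded_ops (ell 2) Y. S = A \<circ> B)"

definition isomorphism ::
  "('i, 'k::real_normed_field) nspace \<Rightarrow> ('j, 'k) nspace \<Rightarrow> (('i \<Rightarrow> 'k) \<Rightarrow> ('j \<Rightarrow> 'k)) \<Rightarrow> bool" where
  "isomorphism X Y U \<longleftrightarrow>
     U \<in> bounded_ops X Y \<and>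
     (\<exists>W\<in>bounded_ops Y X. (\<forall>x\<in>vecs X. W (U x) = x) \<and> (\<forall>y\<in>vecs Y. U (W y) = y))"

text \<open>
  The formal identity from the \<open>p\<close>-sum to the \<open>q\<close>-sum, again extended by zero. For \<open>p \<le> q\<close> the
  carrier of the \<open>p\<close>-sum is contained in that of the \<open>q\<close>-sum.
\<close>

definition formal_identity ::
  "real \<Rightarrow> (nat \<times> nat \<Rightarrow> 'k::real_normed_field) \<Rightarrow> (nat \<times> nat \<Rightarrow> 'k)" where
  "formal_identity p x = (if x \<in> vecs (ell2_sum p) then x else 0)"

definition Pelczynski_decomposition_op ::
  "real \<Rightarrow> real \<Rightarrow> ((nat \<Rightarrow> 'k::real_normed_field) \<Rightarrow> (nat \<Rightarrow> 'k)) \<Rightarrow> bool" where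
  "Pelczynski_decomposition_op p q T \<longleftrightarrow>
     (\<exists>U V. isomorphism (ell p) (ell2_sum p) U \<and> isomorphism (ell2_sum q) (ell q) V \<and>
            T = V \<circ> formal_identity p \<circ> U)"

end

theory Submission
  imports Defs
begin

text \<open>
  One inclusion is formal. Since \<open>p \<le> 2 \<le> q\<close>, the formal identity from the \<open>p\<close>-sum to the
  \<open>q\<close>-sum of the spaces \<open>ell2_fin n\<close> passes through their \<open>2\<close>-sum, which embeds in \<open>ell 2\<close> by
  listing its coordinates. So the operator \<open>T\<close> factors through \<open>ell 2\<close>
  (\<open>formal_identity_factors_through_ell2\<close>). The operators that factor through \<open>ell 2\<close> form an
  ideal, because two copies of \<open>ell 2\<close> can be interleaved into one, and the closure of an ideal is
  a closed ideal (\<open>closed_op_ideal_op_closure\<close>).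

  For the other inclusion let \<open>S = A \<circ> B\<close> with \<open>B\<close> from \<open>ell p\<close> to \<open>ell 2\<close> and \<open>A\<close> from \<open>ell 2\<close> to
  \<open>ell q\<close>. It has to be approximated by operators of the form \<open>V \<circ> formal_identity p \<circ> U\<close>: these lie
  in every ideal that contains \<open>T\<close>, because \<open>T\<close> is the formal identity up to isomorphisms. Every
  bounded operator on \<open>ell p\<close> with \<open>1 < p\<close> is almost a band matrix: its columns have small tails
  because they are vectors of the target space, and its rows have small tails because they are
  bounded functionals (\<open>functional_tail_small\<close>). Hence the coordinates can be divided into
  consecutive finite blocks, the same for \<open>A\<close> and \<open>B\<close>, such that the entries of both matrices that
  are not in the same or in neighbouring blocks are negligible (\<open>common_blocking\<close>).

  Let \<open>Q\<^sub>i\<close> be the projection onto the \<open>i\<close>-th block and \<open>W\<^sub>i\<close> the one onto this block and its two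
  neighbours. Then \<open>S = (\<Sum>i. A Q\<^sub>i B)\<close> is close to \<open>(\<Sum>i. W\<^sub>i A Q\<^sub>i B W\<^sub>i)\<close>. This block sum has the
  required form: \<open>U\<close> sends \<open>x\<close> to the family of the vectors \<open>Q\<^sub>i B W\<^sub>i x\<close>, each placed in a summand
  of its own, and \<open>V\<close> sends a family \<open>y\<close> to \<open>(\<Sum>i. W\<^sub>i A Q\<^sub>i y\<^sub>i)\<close>. Both are bounded, in the
  \<open>p\<close>-norm and in the \<open>q\<close>-norm respectively, because a coordinate belongs to at most three of the
  sets onto which the \<open>W\<^sub>i\<close> project (\<open>product_approx_block_sum\<close>).
\<close>

section \<open>Bounded operators and closed ideals\<close>

locale normed_carrier =
  fixes X :: "('i, 'k::real_normed_field) nspace"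
  assumes zero_mem [simp]: "0 \<in> vecs X"
    and add_mem: "x \<in> vecs X \<Longrightarrow> y \<in> vecs X \<Longrightarrow> x + y \<in> vecs X"
    and scl_mem: "x \<in> vecs X \<Longrightarrow> scl c x \<in> vecs X"
    and nrm_nonneg [simp]: "0 \<le> nrm X x"
    and nrm_triangle: "x \<in> vecs X \<Longrightarrow> y \<in> vecs X \<Longrightarrow> nrm X (x + y) \<le> nrm X x + nrm X y"
    and nrm_scl: "x \<in> vecs X \<Longrightarrow> nrm X (scl c x) = norm c * nrm X x"
begin

lemma nrm_zero [simp]: "nrm X 0 = 0"
  using nrm_scl[of 0 0] by (simp add: scl_def flip: zero_fun_def)

lemma uminus_eq_scl: "- x = scl (- 1) x" for x :: "'i \<Rightarrow> 'k"
  by (simp add: scl_def fun_eq_iff)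

lemma diff_mem: "x \<in> vecs X \<Longrightarrow> y \<in> vecs X \<Longrightarrow> x - y \<in> vecs X"
  using add_mem[of x "- y"] scl_mem[of y "- 1"] by (simp add: uminus_eq_scl[symmetric])

lemma sum_mem:
  "(\<And>i. i \<in> F \<Longrightarrow> f i \<in> vecs X) \<Longrightarrow> (\<Sum>i\<in>F. f i) \<in> vecs X"
  by (induction F rule: infinite_finite_induct) (auto intro: add_mem)

lemma nrm_sum_le:
  "(\<And>i. i \<in> F \<Longrightarrow> f i \<in> vecs X) \<Longrightarrow> nrm X (\<Sum>i\<in>F. f i) \<le> (\<Sum>i\<in>F. nrm X (f i))"
proof (induction F rule: infinite_finite_induct)
  case (insert i F)
  then have "nrm X (f i + sum f F) \<le> nrm X (f i) + nrm X (sum f F)"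
    by (intro nrm_triangle sum_mem) auto
  moreover have "nrm X (sum f F) \<le> (\<Sum>i\<in>F. nrm X (f i))"
    using insert by auto
  ultimately show ?case unfolding sum.insert[OF insert.hyps] by linarith
qed auto

end

lemma bounded_opsI:
  assumes "\<And>x. x \<in> vecs X \<Longrightarrow> T x \<in> vecs Y"
    and "\<And>x y. x \<in> vecs X \<Longrightarrow> y \<in> vecs X \<Longrightarrow> T (x + y) = T x + T y"
    and "\<And>c x. x \<in> vecs X \<Longrightarrow> T (scl c x) = scl c (T x)"
    and "\<And>x. x \<in> vecs X \<Longrightarrow> nrm Y (T x) \<le> C * nrm X x"
    and "\<And>x. x \<notin> vecs X \<Longrightarrow> T x = 0"
  shows "T \<in> bounded_ops X Y"
  using assms unfolding bounded_ops_def by blast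

lemma bounded_ops_mem: "T \<in> bounded_ops X Y \<Longrightarrow> x \<in> vecs X \<Longrightarrow> T x \<in> vecs Y"
  and bounded_ops_add:
    "T \<in> bounded_ops X Y \<Longrightarrow> x \<in> vecs X \<Longrightarrow> y \<in> vecs X \<Longrightarrow> T (x + y) = T x + T y"
  and bounded_ops_scl: "T \<in> bounded_ops X Y \<Longrightarrow> x \<in> vecs X \<Longrightarrow> T (scl c x) = scl c (T x)"
  and bounded_ops_outside: "T \<in> bounded_ops X Y \<Longrightarrow> x \<notin> vecs X \<Longrightarrow> T x = 0"
  by (auto simp: bounded_ops_def)

lemma bounded_ops_zero_arg: "T \<in> bounded_ops X Y \<Longrightarrow> T 0 = 0"
  using bounded_ops_scl[of T X Y 0 0] bounded_ops_outside[of T X Y 0]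
  by (auto simp: scl_def zero_fun_def)

lemma bounded_ops_bound:
  assumes "T \<in> bounded_ops X Y" "\<And>x. 0 \<le> nrm X x"
  obtains C where "C > 0" "\<And>x. x \<in> vecs X \<Longrightarrow> nrm Y (T x) \<le> C * nrm X x"
proof -
  obtain C where C: "\<And>x. x \<in> vecs X \<Longrightarrow> nrm Y (T x) \<le> C * nrm X x"
    using assms(1) unfolding bounded_ops_def by blast
  show ?thesis
  proof (rule that[of "max C 1"])
    fix x assume "x \<in> vecs X"
    then have "nrm Y (T x) \<le> C * nrm X x" by (rule C)
    also have "\<dots> \<le> max C 1 * nrm X x" by (intro mult_right_mono assms(2)) simp
    finally show "nrm Y (T x) \<le> max C 1 * nrm X x" .
  qed simp
qed

lemma bounded_ops_comp:
  assumes B: "B \<in> bounded_ops X Y" and A: "A \<in> bounded_ops Y Z"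
    and nonneg: "\<And>x. 0 \<le> nrm X x" "\<And>y. 0 \<le> nrm Y y"
  shows "A \<circ> B \<in> bounded_ops X Z"
proof -
  obtain CB where CB: "CB > 0" "\<And>x. x \<in> vecs X \<Longrightarrow> nrm Y (B x) \<le> CB * nrm X x"
    using bounded_ops_bound[OF B] nonneg by blast
  obtain CA where CA: "CA > 0" "\<And>x. x \<in> vecs Y \<Longrightarrow> nrm Z (A x) \<le> CA * nrm Y x"
    using bounded_ops_bound[OF A] nonneg by blast
  show ?thesis
  proof (rule bounded_opsI[where C = "CA * CB"])
    fix x assume x: "x \<in> vecs X"
    have "nrm Z (A (B x)) \<le> CA * nrm Y (B x)"
      by (intro CA bounded_ops_mem[OF B] x)
    also have "\<dots> \<le> CA * (CB * nrm X x)"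
      using CA(1) CB(2)[OF x] by (intro mult_left_mono) auto
    finally show "nrm Z ((A \<circ> B) x) \<le> CA * CB * nrm X x" by simp
  qed (simp_all add: bounded_ops_mem[OF A] bounded_ops_mem[OF B] bounded_ops_add[OF A]
      bounded_ops_add[OF B] bounded_ops_scl[OF A] bounded_ops_scl[OF B] bounded_ops_outside[OF B]
      bounded_ops_zero_arg[OF A])
qed

lemma scl_add: "scl c (x + y) = scl c x + scl c y"
  by (simp add: scl_def fun_eq_iff algebra_simps)

lemma scl_scl_commute: "scl c (scl d x) = scl d (scl c x)"
  by (simp add: scl_def fun_eq_iff)

lemma scl_zero [simp]: "scl c 0 = 0"
  by (simp add: scl_def fun_eq_iff)

lemma bounded_ops_plus:
  assumes X: "normed_carrier X" and Y: "normed_carrier Y"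
    and S: "S \<in> bounded_ops X Y" and T: "T \<in> bounded_ops X Y"
  shows "S + T \<in> bounded_ops X Y"
proof -
  interpret X: normed_carrier X by fact
  interpret Y: normed_carrier Y by fact
  obtain C where C: "C > 0" "\<And>x. x \<in> vecs X \<Longrightarrow> nrm Y (S x) \<le> C * nrm X x"
    using bounded_ops_bound[OF S] X.nrm_nonneg by blast
  obtain D where D: "D > 0" "\<And>x. x \<in> vecs X \<Longrightarrow> nrm Y (T x) \<le> D * nrm X x"
    using bounded_ops_bound[OF T] X.nrm_nonneg by blast
  show ?thesis
  proof (rule bounded_opsI[where C = "C + D"])
    fix x assume x: "x \<in> vecs X"
    have "nrm Y (S x + T x) \<le> nrm Y (S x) + nrm Y (T x)"
      by (intro Y.nrm_triangle bounded_ops_mem[OF S] bounded_ops_mem[OF T] x)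
    with C(2)[OF x] D(2)[OF x] show "nrm Y ((S + T) x) \<le> (C + D) * nrm X x"
      by (simp add: algebra_simps)
  qed (simp_all add: bounded_ops_mem[OF S] bounded_ops_mem[OF T] bounded_ops_add[OF S]
      bounded_ops_add[OF T] bounded_ops_scl[OF S] bounded_ops_scl[OF T] bounded_ops_outside[OF S]
      bounded_ops_outside[OF T] scl_add Y.add_mem algebra_simps)
qed

lemma bounded_ops_scale:
  assumes Y: "normed_carrier Y" and T: "T \<in> bounded_ops X Y"
  shows "(\<lambda>x. scl c (T x)) \<in> bounded_ops X Y"
proof -
  interpret Y: normed_carrier Y by fact
  obtain C where C: "\<And>x. x \<in> vecs X \<Longrightarrow> nrm Y (T x) \<le> C * nrm X x"
    using T unfolding bounded_ops_def by blast
  show ?thesis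
    by (rule bounded_opsI[where C = "norm c * C"])
      (use C in \<open>auto simp: bounded_ops_mem[OF T] bounded_ops_add[OF T] bounded_ops_scl[OF T]
        Y.scl_mem Y.nrm_scl bounded_ops_outside[OF T] scl_add mult.assoc
        intro: mult_left_mono scl_scl_commute\<close>)
qed

lemma bounded_ops_zero:
  assumes "normed_carrier X" "normed_carrier Y"
  shows "0 \<in> bounded_ops X Y"
proof -
  interpret X: normed_carrier X by fact
  interpret Y: normed_carrier Y by fact
  show ?thesis by (rule bounded_opsI[where C = 0]) auto
qed

lemma op_norm_le:
  assumes X: "normed_carrier X" and "0 \<le> c"
    and le: "\<And>x. x \<in> vecs X \<Longrightarrow> nrm Y (T x) \<le> c * nrm X x"
  shows "op_norm X Y T \<le> c"
  unfolding op_norm_def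
proof (rule cSUP_least)
  interpret X: normed_carrier X by fact
  show "{x \<in> vecs X. nrm X x \<le> 1} \<noteq> {}"
    using X.zero_mem X.nrm_zero zero_le_one by fastforce
  fix x assume "x \<in> {x \<in> vecs X. nrm X x \<le> 1}"
  then have "nrm Y (T x) \<le> c * nrm X x" "c * nrm X x \<le> c * 1"
    using le \<open>0 \<le> c\<close> by (blast, intro mult_left_mono) auto
  then show "nrm Y (T x) \<le> c" by simp
qed

lemma nrm_le_op_norm:
  assumes X: "normed_carrier X" and Y: "normed_carrier Y"
    and T: "T \<in> bounded_ops X Y" and x: "x \<in> vecs X"
  shows "nrm Y (T x) \<le> op_norm X Y T * nrm X x"
proof -
  interpret X: normed_carrier X by fact
  interpret Y: normed_carrier Y by fact
  obtain C where C: "C > 0" "\<And>x. x \<in> vecs X \<Longrightarrow> nrm Y (T x) \<le> C * nrm X x"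
    using bounded_ops_bound[OF T] X.nrm_nonneg by blast
  show ?thesis
  proof (cases "nrm X x = 0")
    case True
    with C(2)[OF x] show ?thesis by simp
  next
    case False
    define c where "c = (inverse (of_real (nrm X x)) :: 'b)"
    have pos: "nrm X x > 0" using False X.nrm_nonneg[of x] by linarith
    have norm_c: "norm c = inverse (nrm X x)"
      using pos by (simp add: c_def norm_inverse)
    have "nrm Y (T (scl c x)) \<le> op_norm X Y T"
      unfolding op_norm_def
    proof (rule cSUP_upper)
      show "scl c x \<in> {x \<in> vecs X. nrm X x \<le> 1}"
        using x pos by (simp add: X.scl_mem X.nrm_scl norm_c)
      show "bdd_above ((\<lambda>x. nrm Y (T x)) ` {x \<in> vecs X. nrm X x \<le> 1})"
      proof (rule bdd_aboveI2)
        fix x assume "x \<in> {x \<in> vecs X. nrm X x \<le> 1}"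
        then have "nrm Y (T x) \<le> C * nrm X x" "C * nrm X x \<le> C * 1"
          using C by (blast, intro mult_left_mono) auto
        then show "nrm Y (T x) \<le> C" by simp
      qed
    qed
    then have "norm c * nrm Y (T x) \<le> op_norm X Y T"
      using x by (simp add: bounded_ops_scl[OF T] Y.nrm_scl bounded_ops_mem[OF T])
    then show ?thesis using pos by (simp add: norm_c field_simps)
  qed
qed

lemma bounded_ops_minus:
  assumes "normed_carrier X" "normed_carrier Y"
    and "S \<in> bounded_ops X Y" "T \<in> bounded_ops X Y"
  shows "S - T \<in> bounded_ops X Y"
proof -
  have "S - T = S + (\<lambda>x. scl (- 1) (T x))"
    by (simp add: scl_def fun_eq_iff)
  also have "\<dots> \<in> bounded_ops X Y"
    by (intro bounded_ops_plus bounded_ops_scale assms)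
  finally show ?thesis .
qed

text \<open>
  Trades the supremum in \<open>op_norm\<close> for an inequality at each vector, which is the form in which
  approximations are produced and consumed below.
\<close>

lemma op_closure_iff:
  assumes X: "normed_carrier X" and Y: "normed_carrier Y" and J: "J \<subseteq> bounded_ops X Y"
  shows "S \<in> op_closure X Y J \<longleftrightarrow>
    S \<in> bounded_ops X Y \<and> (\<forall>e>0. \<exists>R\<in>J. \<forall>x\<in>vecs X. nrm Y (S x - R x) \<le> e * nrm X x)"
    (is "_ \<longleftrightarrow> ?S \<and> ?approx")
proof
  assume S: "S \<in> op_closure X Y J"
  then have mem: "S \<in> bounded_ops X Y" by (simp add: op_closure_def)
  have "\<exists>R\<in>J. \<forall>x\<in>vecs X. nrm Y (S x - R x) \<le> e * nrm X x" if "e > 0" for e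
  proof -
    from S that obtain R where R: "R \<in> J" "op_norm X Y (S - R) < e"
      by (auto simp: op_closure_def)
    have "nrm Y (S x - R x) \<le> e * nrm X x" if x: "x \<in> vecs X" for x
    proof -
      have "nrm Y ((S - R) x) \<le> op_norm X Y (S - R) * nrm X x"
        using R J mem x X Y by (intro nrm_le_op_norm bounded_ops_minus) auto
      also have "\<dots> \<le> e * nrm X x"
        using R normed_carrier.nrm_nonneg[OF X] by (intro mult_right_mono) auto
      finally show ?thesis by simp
    qed
    with R show ?thesis by blast
  qed
  with mem show "?S \<and> ?approx" by blast
next
  assume S: "?S \<and> ?approx"
  have "\<exists>R\<in>J. op_norm X Y (S - R) < e" if e: "e > 0" for e
  proof -
    from S e obtain R where R: "R \<in> J" "\<forall>x\<in>vecs X. nrm Y (S x - R x) \<le> e / 2 * nrm X x"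
      by (meson half_gt_zero)
    have "op_norm X Y (S - R) \<le> e / 2"
      using e R by (intro op_norm_le X) auto
    with R e show ?thesis by force
  qed
  with S show "S \<in> op_closure X Y J" by (auto simp: op_closure_def)
qed

text \<open>
  The ideal operations are continuous: approximating the operands by members of \<open>J\<close> approximates
  the result. In a composition the error allowed for the middle factor is divided by bounds for the
  two outer factors.
\<close>

lemma closed_op_ideal_op_closure:
  assumes X: "normed_carrier X" and Y: "normed_carrier Y" and J: "op_ideal X Y J"
  shows "closed_op_ideal X Y (op_closure X Y J)"
proof -
  interpret X: normed_carrier X by fact
  interpret Y: normed_carrier Y by fact
  let ?K = "op_closure X Y J"
  have sub: "J \<subseteq> bounded_ops X Y" using J by (simp add: op_ideal_def)
  have Ksub: "?K \<subseteq> bounded_ops X Y" by (auto simp: op_closure_def)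
  note iff = op_closure_iff[OF X Y sub] and iffK = op_closure_iff[OF X Y Ksub]
  have memJ: "R x \<in> vecs Y" if "R \<in> J" "x \<in> vecs X" for R x
    using bounded_ops_mem[of R X Y x] that sub by blast
  have memK: "R x \<in> vecs Y" if "R \<in> ?K" "x \<in> vecs X" for R x
    using bounded_ops_mem[of R X Y x] that Ksub by blast
  have JK: "J \<subseteq> ?K"
  proof
    fix S assume "S \<in> J"
    then show "S \<in> ?K" using sub unfolding iff by (force intro!: bexI[of _ S])
  qed
  have KKK: "op_closure X Y ?K = ?K"
  proof (intro equalityI subsetI)
    fix S assume S: "S \<in> ?K"
    then show "S \<in> op_closure X Y ?K" using Ksub unfolding iffK by (force intro!: bexI[of _ S])
  next
    fix S assume S: "S \<in> op_closure X Y ?K"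
    have "\<exists>R\<in>J. \<forall>x\<in>vecs X. nrm Y (S x - R x) \<le> e * nrm X x" if "e > 0" for e
    proof -
      from S \<open>e > 0\<close> obtain R where R: "R \<in> ?K" "\<forall>x\<in>vecs X. nrm Y (S x - R x) \<le> e / 2 * nrm X x"
        unfolding iffK by (meson half_gt_zero)
      then obtain Q where Q: "Q \<in> J" "\<forall>x\<in>vecs X. nrm Y (R x - Q x) \<le> e / 2 * nrm X x"
        unfolding iff using \<open>e > 0\<close> by (meson half_gt_zero)
      have "nrm Y (S x - Q x) \<le> e * nrm X x" if x: "x \<in> vecs X" for x
      proof -
        have "S x \<in> vecs Y"
          using S iffK bounded_ops_mem[of S X Y x] x by blast
        moreover have "R x \<in> vecs Y" "Q x \<in> vecs Y"
          using memK[OF R(1) x] memJ[OF Q(1) x] by auto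
        ultimately have "nrm Y ((S x - R x) + (R x - Q x)) \<le> nrm Y (S x - R x) + nrm Y (R x - Q x)"
          by (intro Y.nrm_triangle Y.diff_mem)
        with R(2) Q(2) x show ?thesis by fastforce
      qed
      with Q show ?thesis by blast
    qed
    with S show "S \<in> ?K" unfolding iff iffK by blast
  qed
  have plus: "S + T \<in> ?K" if S: "S \<in> ?K" and T: "T \<in> ?K" for S T
    unfolding iff
  proof (intro conjI allI impI)
    show "S + T \<in> bounded_ops X Y" using S T Ksub X Y by (intro bounded_ops_plus) auto
    fix e :: real assume "e > 0"
    from S \<open>e > 0\<close> obtain P where P: "P \<in> J" "\<forall>x\<in>vecs X. nrm Y (S x - P x) \<le> e / 2 * nrm X x"
      unfolding iff by (meson half_gt_zero)
    from T \<open>e > 0\<close> obtain Q where Q: "Q \<in> J" "\<forall>x\<in>vecs X. nrm Y (T x - Q x) \<le> e / 2 * nrm X x"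
      unfolding iff by (meson half_gt_zero)
    show "\<exists>R\<in>J. \<forall>x\<in>vecs X. nrm Y ((S + T) x - R x) \<le> e * nrm X x"
    proof (intro bexI ballI)
      show "P + Q \<in> J" using P Q J by (simp add: op_ideal_def)
      fix x assume x: "x \<in> vecs X"
      have "S x \<in> vecs Y" "T x \<in> vecs Y" "P x \<in> vecs Y" "Q x \<in> vecs Y"
        using memK[OF S x] memK[OF T x] memJ[OF P(1) x] memJ[OF Q(1) x] by auto
      then have "nrm Y ((S x - P x) + (T x - Q x)) \<le> nrm Y (S x - P x) + nrm Y (T x - Q x)"
        by (intro Y.nrm_triangle Y.diff_mem)
      moreover have eq: "(S + T) x - (P + Q) x = (S x - P x) + (T x - Q x)" by simp
      moreover have "nrm Y (S x - P x) \<le> e / 2 * nrm X x" "nrm Y (T x - Q x) \<le> e / 2 * nrm X x"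
        using P(2) Q(2) x by auto
      ultimately show "nrm Y ((S + T) x - (P + Q) x) \<le> e * nrm X x"
        unfolding eq by linarith
    qed
  qed
  have scale: "(\<lambda>x. scl c (S x)) \<in> ?K" if S: "S \<in> ?K" for S c
    unfolding iff
  proof (intro conjI allI impI)
    show "(\<lambda>x. scl c (S x)) \<in> bounded_ops X Y" using S Ksub Y by (intro bounded_ops_scale) auto
    fix e :: real assume "e > 0"
    then have "e / (norm c + 1) > 0" by (simp add: add_nonneg_pos)
    with S obtain P where P: "P \<in> J"
      "\<forall>x\<in>vecs X. nrm Y (S x - P x) \<le> e / (norm c + 1) * nrm X x"
      unfolding iff by blast
    show "\<exists>R\<in>J. \<forall>x\<in>vecs X. nrm Y (scl c (S x) - R x) \<le> e * nrm X x"
    proof (intro bexI ballI)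
      show "(\<lambda>x. scl c (P x)) \<in> J" using P J by (simp add: op_ideal_def)
      fix x assume x: "x \<in> vecs X"
      have mem: "S x - P x \<in> vecs Y"
        by (intro Y.diff_mem memK[OF S x] memJ[OF P(1) x])
      have "scl c (S x) - scl c (P x) = scl c (S x - P x)"
        by (simp add: scl_def fun_eq_iff algebra_simps)
      then have "nrm Y (scl c (S x) - scl c (P x)) = norm c * nrm Y (S x - P x)"
        using mem by (simp add: Y.nrm_scl)
      also have "\<dots> \<le> (norm c + 1) * (e / (norm c + 1) * nrm X x)"
        using P(2) x by (intro mult_mono) auto
      also have "\<dots> = e * nrm X x"
        using norm_ge_zero[of c] by (simp add: field_simps add_nonneg_eq_0_iff)
      finally show "nrm Y (scl c (S x) - scl c (P x)) \<le> e * nrm X x" .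
    qed
  qed
  have comp: "A \<circ> S \<circ> B \<in> ?K"
    if A: "A \<in> bounded_ops Y Y" and S: "S \<in> ?K" and B: "B \<in> bounded_ops X X" for A S B
    unfolding iff
  proof (intro conjI allI impI)
    have S': "S \<in> bounded_ops X Y" using S Ksub by auto
    show "A \<circ> S \<circ> B \<in> bounded_ops X Y"
      by (intro bounded_ops_comp[OF B] bounded_ops_comp[OF S'] A) auto
    obtain CA where CA: "CA > 0" "\<And>y. y \<in> vecs Y \<Longrightarrow> nrm Y (A y) \<le> CA * nrm Y y"
      using bounded_ops_bound[OF A] Y.nrm_nonneg by blast
    obtain CB where CB: "CB > 0" "\<And>x. x \<in> vecs X \<Longrightarrow> nrm X (B x) \<le> CB * nrm X x"
      using bounded_ops_bound[OF B] X.nrm_nonneg by blast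
    fix e :: real assume "e > 0"
    then have "e / (CA * CB) > 0" using CA CB by simp
    with S obtain P where P: "P \<in> J"
      "\<forall>x\<in>vecs X. nrm Y (S x - P x) \<le> e / (CA * CB) * nrm X x"
      unfolding iff by blast
    show "\<exists>R\<in>J. \<forall>x\<in>vecs X. nrm Y ((A \<circ> S \<circ> B) x - R x) \<le> e * nrm X x"
    proof (intro bexI ballI)
      show "A \<circ> P \<circ> B \<in> J" using A B P J by (simp add: op_ideal_def)
      fix x assume x: "x \<in> vecs X"
      have Bx: "B x \<in> vecs X" using B x by (rule bounded_ops_mem)
      have mem: "S (B x) \<in> vecs Y" "P (B x) \<in> vecs Y" "S (B x) - P (B x) \<in> vecs Y"
        by (intro Y.diff_mem memK[OF S Bx] memJ[OF P(1) Bx])+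
      have "A (S (B x)) = A (S (B x) - P (B x)) + A (P (B x))"
        using bounded_ops_add[OF A mem(3) mem(2)] by simp
      then have "nrm Y ((A \<circ> S \<circ> B) x - (A \<circ> P \<circ> B) x) = nrm Y (A (S (B x) - P (B x)))"
        by simp
      also have "\<dots> \<le> CA * nrm Y (S (B x) - P (B x))" by (intro CA mem)
      also have "\<dots> \<le> CA * (e / (CA * CB) * nrm X (B x))"
        using CA P(2) Bx by (intro mult_left_mono) auto
      also have "\<dots> \<le> CA * (e / (CA * CB) * (CB * nrm X x))"
        using CA CB(1) CB(2)[OF x] \<open>e > 0\<close> by (intro mult_left_mono) auto
      also have "\<dots> = e * nrm X x" using CA CB by simp
      finally show "nrm Y ((A \<circ> S \<circ> B) x - (A \<circ> P \<circ> B) x) \<le> e * nrm X x" .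
    qed
  qed
  have "0 \<in> ?K" using JK J by (auto simp: op_ideal_def)
  with Ksub plus scale comp KKK show ?thesis
    unfolding closed_op_ideal_def op_ideal_def by blast
qed

section \<open>The sequence spaces\<close>

lemma ell_mem_iff: "x \<in> vecs (ell p) \<longleftrightarrow> summable (\<lambda>n. norm (x n) powr p)"
  by (simp add: ell_def)

lemma nrm_ell: "nrm (ell p) x = (\<Sum>n. norm (x n) powr p) powr (1 / p)"
  by (simp add: ell_def)

lemma nrm_ell_nonneg [simp]: "0 \<le> nrm (ell p) x"
  by (simp add: nrm_ell)

text \<open>
  Bounds on finite partial sums give membership and the norm estimate at once. Nearly every
  estimate below is reduced to finite sums by this lemma and its converse \<open>ell_sum_le\<close>.
\<close>

lemma ell_boundI:
  assumes "0 < p" "0 \<le> c" and le: "\<And>M. (\<Sum>n<M. norm (x n) powr p) \<le> c powr p"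
  shows "x \<in> vecs (ell p)" and "nrm (ell p) x \<le> c"
proof -
  have sm: "summable (\<lambda>n. norm (x n) powr p)"
    by (rule summableI_nonneg_bounded[OF _ le]) simp
  then show "x \<in> vecs (ell p)" by (simp add: ell_mem_iff)
  have "(\<Sum>n. norm (x n) powr p) \<le> c powr p"
    by (rule suminf_le_const[OF sm le])
  then have "nrm (ell p) x \<le> (c powr p) powr (1 / p)"
    unfolding nrm_ell using assms sm by (intro powr_mono2 suminf_nonneg) auto
  then show "nrm (ell p) x \<le> c" using assms by (simp add: powr_powr)
qed

lemma ell_sum_le:
  assumes "0 < p" "x \<in> vecs (ell p)" "finite F"
  shows "(\<Sum>n\<in>F. norm (x n) powr p) \<le> nrm (ell p) x powr p"
proof -
  have sm: "summable (\<lambda>n. norm (x n) powr p)" using assms by (simp add: ell_mem_iff)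
  have "nrm (ell p) x powr p = (\<Sum>n. norm (x n) powr p)"
    using assms sm by (simp add: nrm_ell powr_powr suminf_nonneg)
  then show ?thesis using sum_le_suminf[OF sm \<open>finite F\<close>] by simp
qed

lemma norm_coord_le:
  assumes "0 < p" "x \<in> vecs (ell p)"
  shows "norm (x n) \<le> nrm (ell p) x"
proof -
  have "norm (x n) powr p \<le> nrm (ell p) x powr p"
    using ell_sum_le[OF assms, of "{n}"] by simp
  then show ?thesis
    using assms by (meson linorder_not_less nrm_ell_nonneg powr_less_mono2)
qed

lemma ell_dominated:
  assumes "0 < p" "y \<in> vecs (ell p)" and le: "\<And>n. norm (x n) \<le> norm (y n)"
  shows "x \<in> vecs (ell p)" and "nrm (ell p) x \<le> nrm (ell p) y"
proof -
  have "(\<Sum>n<M. norm (x n) powr p) \<le> nrm (ell p) y powr p" for M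
  proof -
    have "(\<Sum>n<M. norm (x n) powr p) \<le> (\<Sum>n<M. norm (y n) powr p)"
      using assms by (intro sum_mono powr_mono2) auto
    also have "\<dots> \<le> nrm (ell p) y powr p" using assms by (intro ell_sum_le) auto
    finally show ?thesis .
  qed
  from ell_boundI[OF \<open>0 < p\<close> _ this]
  show "x \<in> vecs (ell p)" and "nrm (ell p) x \<le> nrm (ell p) y" by auto
qed

text \<open>
  Every coordinate is at most \<open>c\<close>, the norm in \<open>ell r\<close>; so raising the exponent from \<open>r\<close> to \<open>s\<close>
  costs at most the factor \<open>c powr (s - r)\<close> in each term.
\<close>

lemma ell_mono_exponent:
  assumes "0 < r" "r \<le> s" and x: "x \<in> vecs (ell r)"
  shows "x \<in> vecs (ell s)" and "nrm (ell s) x \<le> nrm (ell r) x"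
proof -
  define c where "c = nrm (ell r) x"
  have "(\<Sum>n<M. norm (x n) powr s) \<le> c powr s" for M
  proof -
    have "norm (x n) powr s \<le> c powr (s - r) * norm (x n) powr r" for n
    proof -
      have "norm (x n) powr s = norm (x n) powr (s - r) * norm (x n) powr r"
        by (simp flip: powr_add)
      also have "\<dots> \<le> c powr (s - r) * norm (x n) powr r"
        using assms norm_coord_le[of r x n]
        by (intro mult_right_mono powr_mono2) (auto simp: c_def)
      finally show ?thesis .
    qed
    then have "(\<Sum>n<M. norm (x n) powr s) \<le> c powr (s - r) * (\<Sum>n<M. norm (x n) powr r)"
      unfolding sum_distrib_left by (intro sum_mono)
    also have "\<dots> \<le> c powr (s - r) * c powr r"
      unfolding c_def using assms by (intro mult_left_mono ell_sum_le) auto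
    also have "\<dots> = c powr s" by (simp flip: powr_add)
    finally show ?thesis .
  qed
  moreover have "0 < s" "0 \<le> c" using assms by (auto simp: c_def)
  ultimately show "x \<in> vecs (ell s)" and "nrm (ell s) x \<le> nrm (ell r) x"
    using ell_boundI[of s c x] by (auto simp: c_def)
qed

lemma powr_convex_combination:
  fixes u v t p :: real
  assumes "1 \<le> p" "0 \<le> u" "0 \<le> v" "0 \<le> t" "t \<le> 1"
  shows "(t * u + (1 - t) * v) powr p \<le> t * u powr p + (1 - t) * v powr p"
proof -
  have shrink: "(s * w) powr p \<le> s * w powr p" if "0 \<le> s" "s \<le> 1" for s w :: real
    using that powr_mono'[of 1 p s] assms by (auto simp: powr_mult intro: mult_right_mono)
  consider "u = 0" | "v = 0" | "u > 0" "v > 0" using assms by fastforce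
  then show ?thesis
  proof cases
    case 3
    then show ?thesis
      using convex_onD[OF powr_convex[OF assms(1)], of "1 - t" u v] assms by auto
  qed (use shrink[of t u] shrink[of "1 - t" v] assms in auto)
qed

text \<open>
  Minkowski's inequality, from the convexity of \<open>t \<mapsto> t powr p\<close>: with \<open>t = a / (a + b)\<close> the sum
  \<open>f n + g n\<close> is \<open>a + b\<close> times the convex combination of \<open>f n / a\<close> and \<open>g n / b\<close> with weights
  \<open>t\<close> and \<open>1 - t\<close>.
\<close>

lemma sum_powr_Minkowski:
  fixes f g :: "'a \<Rightarrow> real"
  assumes "1 \<le> p" "finite F" "0 \<le> a" "0 \<le> b"
    and nonneg: "\<And>n. 0 \<le> f n" "\<And>n. 0 \<le> g n"
    and f: "(\<Sum>n\<in>F. f n powr p) \<le> a powr p" and g: "(\<Sum>n\<in>F. g n powr p) \<le> b powr p"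
  shows "(\<Sum>n\<in>F. (f n + g n) powr p) \<le> (a + b) powr p"
proof -
  have vanish: "h n = 0" if "(\<Sum>n\<in>F. h n powr p) \<le> 0 powr p" "n \<in> F" for h :: "'a \<Rightarrow> real" and n
  proof -
    have "(\<Sum>n\<in>F. h n powr p) = 0" using that sum_nonneg[of F "\<lambda>n. h n powr p"] by simp
    then show ?thesis using that \<open>finite F\<close> by (simp add: sum_nonneg_eq_0_iff)
  qed
  consider "a = 0" | "b = 0" | "a > 0" "b > 0" using assms by fastforce
  then show ?thesis
  proof cases
    case 1
    then have "(\<Sum>n\<in>F. (f n + g n) powr p) = (\<Sum>n\<in>F. g n powr p)"
      using vanish[of f] f by (intro sum.cong) auto
    with g 1 show ?thesis by simp
  next
    case 2
    then have "(\<Sum>n\<in>F. (f n + g n) powr p) = (\<Sum>n\<in>F. f n powr p)"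
      using vanish[of g] g by (intro sum.cong) auto
    with f 2 show ?thesis by simp
  next
    case 3
    define t where "t = a / (a + b)"
    have t: "0 \<le> t" "t \<le> 1" "1 - t = b / (a + b)" using 3 by (auto simp: t_def field_simps)
    have "(f n + g n) powr p \<le>
        (a + b) powr p * (t * (f n powr p / a powr p) + (1 - t) * (g n powr p / b powr p))" for n
    proof -
      have "f n + g n = (a + b) * (t * (f n / a) + (1 - t) * (g n / b))"
        unfolding t(3) using 3 by (simp add: t_def distrib_left)
      then have "(f n + g n) powr p = (a + b) powr p * (t * (f n / a) + (1 - t) * (g n / b)) powr p"
        by (simp add: powr_mult)
      also have "\<dots> \<le> (a + b) powr p * (t * (f n / a) powr p + (1 - t) * (g n / b) powr p)"
        using 3 nonneg t assms by (intro mult_left_mono powr_convex_combination) auto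
      finally show ?thesis by (simp add: powr_divide)
    qed
    then have "(\<Sum>n\<in>F. (f n + g n) powr p) \<le>
        (\<Sum>n\<in>F. (a + b) powr p * (t * (f n powr p / a powr p) + (1 - t) * (g n powr p / b powr p)))"
      by (rule sum_mono)
    also have "\<dots> = (a + b) powr p * (t * ((\<Sum>n\<in>F. f n powr p) / a powr p)
        + (1 - t) * ((\<Sum>n\<in>F. g n powr p) / b powr p))"
      unfolding sum_divide_distrib sum_distrib_left
      by (simp add: sum.distrib flip: sum_distrib_left)
    also have "\<dots> \<le> (a + b) powr p * (t * 1 + (1 - t) * 1)"
      using t f g 3 by (intro mult_left_mono add_mono) auto
    finally show ?thesis by simp
  qed
qed

lemma normed_carrier_ell:
  assumes "1 \<le> p"
  shows "normed_carrier (ell p :: (nat, 'k::real_normed_field) nspace)"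
proof
  fix x y :: "nat \<Rightarrow> 'k" and c :: 'k
  have p: "0 < p" using assms by simp
  show "0 \<in> vecs (ell p :: (nat, 'k) nspace)" using p by (simp add: ell_mem_iff)
  show "0 \<le> nrm (ell p) x" by simp
  {
    assume x: "x \<in> vecs (ell p)"
    then have sm: "summable (\<lambda>n. norm (x n) powr p)" by (simp add: ell_mem_iff)
    then show "scl c x \<in> vecs (ell p)"
      by (simp add: ell_mem_iff scl_def norm_mult powr_mult summable_mult)
    show "nrm (ell p) (scl c x) = norm c * nrm (ell p) x"
      using p sm by (simp add: nrm_ell scl_def norm_mult powr_mult suminf_mult powr_powr)
    assume y: "y \<in> vecs (ell p)"
    have "(\<Sum>n<M. norm ((x + y) n) powr p) \<le> (nrm (ell p) x + nrm (ell p) y) powr p" for M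
    proof -
      have "(\<Sum>n<M. norm ((x + y) n) powr p) \<le> (\<Sum>n<M. (norm (x n) + norm (y n)) powr p)"
        using p by (intro sum_mono powr_mono2) (auto simp: norm_triangle_ineq)
      also have "\<dots> \<le> (nrm (ell p) x + nrm (ell p) y) powr p"
        using assms p x y by (intro sum_powr_Minkowski ell_sum_le) auto
      finally show ?thesis .
    qed
    note bound = ell_boundI[OF p _ this]
    show "x + y \<in> vecs (ell p)" by (rule bound) simp
    show "nrm (ell p) (x + y) \<le> nrm (ell p) x + nrm (ell p) y" by (rule bound) simp
  }
qed

definition proj :: "nat set \<Rightarrow> (nat \<Rightarrow> 'k::zero) \<Rightarrow> (nat \<Rightarrow> 'k)" where
  "proj D x = (\<lambda>i. if i \<in> D then x i else 0)"

lemma proj_apply: "proj D x i = (if i \<in> D then x i else 0)"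
  by (simp add: proj_def)

lemma proj_add: "proj D (x + y) = proj D x + proj D y"
  for x y :: "nat \<Rightarrow> 'k::real_normed_field"
  by (auto simp: proj_def fun_eq_iff)

lemma proj_scl: "proj D (scl c x) = scl c (proj D x)"
  by (auto simp: proj_def scl_def fun_eq_iff)

lemma proj_proj: "proj D (proj E x) = proj (D \<inter> E) x"
  by (auto simp: proj_def fun_eq_iff)

lemma proj_Un: "D \<inter> E = {} \<Longrightarrow> proj (D \<union> E) x = proj D x + proj E x"
  for x :: "nat \<Rightarrow> 'k::real_normed_field"
  by (auto simp: proj_def fun_eq_iff)

lemma proj_empty [simp]: "proj {} x = 0"
  by (simp add: proj_def fun_eq_iff)

lemma proj_zero [simp]: "proj D 0 = 0"
  by (simp add: proj_def fun_eq_iff)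

lemma proj_cong: "(\<And>n. n \<in> D \<Longrightarrow> x n = y n) \<Longrightarrow> proj D x = proj D y"
  by (auto simp: proj_def)

lemma proj_mem: "0 < p \<Longrightarrow> x \<in> vecs (ell p) \<Longrightarrow> proj D x \<in> vecs (ell p)"
  and nrm_proj_le: "0 < p \<Longrightarrow> x \<in> vecs (ell p) \<Longrightarrow> nrm (ell p) (proj D x) \<le> nrm (ell p) x"
  using ell_dominated[of p x "proj D x"] by (auto simp: proj_def)

lemma nrm_proj_mono:
  assumes "0 < p" "x \<in> vecs (ell p)" "D \<subseteq> E"
  shows "nrm (ell p) (proj D x) \<le> nrm (ell p) (proj E x)"
proof (rule ell_dominated(2))
  show "norm (proj D x n) \<le> norm (proj E x n)" for n
    using assms by (auto simp: proj_apply)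
qed (use assms in \<open>auto intro: proj_mem\<close>)

lemma nrm_tail_small:
  assumes p: "0 < p" and x: "x \<in> vecs (ell p)" and e: "0 < e"
  shows "\<forall>\<^sub>F m in sequentially. nrm (ell p) (proj {m..} x) \<le> e"
proof -
  have "summable (\<lambda>n. norm (x n) powr p)" using x by (simp add: ell_mem_iff)
  moreover have "0 < e powr p" using e by simp
  ultimately obtain N where N: "\<And>m n. N \<le> m \<Longrightarrow> norm (\<Sum>n=m..<n. norm (x n) powr p) < e powr p"
    unfolding summable_Cauchy by blast
  have "nrm (ell p) (proj {m..} x) \<le> e" if "N \<le> m" for m
  proof (rule ell_boundI(2)[OF p])
    fix M
    have "(\<Sum>n<M. norm (proj {m..} x n) powr p) = (\<Sum>n=m..<M. norm (x n) powr p)"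
      by (rule sum.mono_neutral_cong_right) (auto simp: proj_def)
    also have "\<dots> \<le> e powr p" using N[OF that, of M] by simp
    finally show "(\<Sum>n<M. norm (proj {m..} x n) powr p) \<le> e powr p" .
  qed (use e in simp)
  then show ?thesis unfolding eventually_sequentially by blast
qed

lemma nrm_disjoint_add_powr_le:
  assumes p: "0 < p" and x: "x \<in> vecs (ell p)" and y: "y \<in> vecs (ell p)"
    and disj: "\<And>n. x n = 0 \<or> y n = 0"
  shows "nrm (ell p) (x + y) powr p \<le> nrm (ell p) x powr p + nrm (ell p) y powr p"
proof -
  define s where "s = nrm (ell p) x powr p + nrm (ell p) y powr p"
  have s: "0 \<le> s" by (simp add: s_def)
  have "nrm (ell p) (x + y) \<le> s powr (1 / p)"
  proof (rule ell_boundI(2)[OF p])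
    fix M
    have "norm ((x + y) n) powr p = norm (x n) powr p + norm (y n) powr p" for n
      using disj[of n] p by auto
    then have "(\<Sum>n<M. norm ((x + y) n) powr p) =
        (\<Sum>n<M. norm (x n) powr p) + (\<Sum>n<M. norm (y n) powr p)"
      by (simp add: sum.distrib)
    also have "\<dots> \<le> s" unfolding s_def using p x y by (intro add_mono ell_sum_le) auto
    finally show "(\<Sum>n<M. norm ((x + y) n) powr p) \<le> (s powr (1 / p)) powr p"
      using p s by (simp add: powr_powr)
  qed simp
  then have "nrm (ell p) (x + y) powr p \<le> (s powr (1 / p)) powr p"
    using p by (intro powr_mono2) auto
  then show ?thesis using p s by (simp add: powr_powr s_def)
qed

section \<open>Operators are almost banded\<close>

text \<open>
  A gliding hump. If the functional were not small on tails, there would be vectors of norm at most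
  \<open>1 / e\<close> with successive disjoint supports on which it is \<open>1\<close>. The sum of \<open>N\<close> of them has norm at
  most \<open>N powr (1 / p) / e\<close>, but the functional takes the value \<open>N\<close> there. As \<open>1 < p\<close>, this is
  incompatible with boundedness when \<open>N\<close> is large.
\<close>

lemma functional_tail_small:
  fixes f :: "(nat \<Rightarrow> 'k::real_normed_field) \<Rightarrow> 'k"
  assumes p: "1 < p" and e: "0 < e"
    and add: "\<And>x y. x \<in> vecs (ell p) \<Longrightarrow> y \<in> vecs (ell p) \<Longrightarrow> f (x + y) = f x + f y"
    and scl: "\<And>c x. x \<in> vecs (ell p) \<Longrightarrow> f (scl c x) = c * f x"
    and bound: "\<And>x. x \<in> vecs (ell p) \<Longrightarrow> norm (f x) \<le> C * nrm (ell p) x"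
  shows "\<exists>m. \<forall>x\<in>vecs (ell p). norm (f (proj {m..} x)) \<le> e * nrm (ell p) x"
proof (rule ccontr)
  assume contra: "\<not> ?thesis"
  interpret normed_carrier "ell p :: (nat, 'k) nspace" using p by (intro normed_carrier_ell) simp
  have p0: "0 < p" using p by simp
  have block: "\<exists>M z. z \<in> vecs (ell p) \<and> (\<forall>i. i < m \<or> M \<le> i \<longrightarrow> z i = 0) \<and> f z = 1 \<and>
      nrm (ell p) z \<le> 1 / e" for m
  proof -
    obtain x where x: "x \<in> vecs (ell p)" "norm (f (proj {m..} x)) > e * nrm (ell p) x"
      using contra by (meson linorder_not_less)
    \<comment> \<open>\<open>g\<close> is so small that dropping a tail of norm \<open>g\<close> preserves the strict inequality for \<open>x\<close>;
      the summand \<open>1\<close> avoids a division by zero.\<close>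
    define g where "g = (norm (f (proj {m..} x)) - e * nrm (ell p) x) / (1 + \<bar>C\<bar>)"
    have "0 < g" using x by (simp add: g_def)
    from eventually_conj[OF nrm_tail_small[OF p0 x(1) this] eventually_ge_at_top[of m]]
    obtain M where M: "nrm (ell p) (proj {M..} x) \<le> g" "m \<le> M"
      unfolding eventually_sequentially by blast
    define y where "y = proj {m..<M} x"
    have mem: "y \<in> vecs (ell p)" "proj {M..} x \<in> vecs (ell p)"
      using x p0 by (auto simp: y_def proj_mem)
    have "proj {m..} x = y + proj {M..} x"
      using M by (auto simp: y_def proj_def fun_eq_iff)
    then have "norm (f (proj {m..} x)) \<le> norm (f y) + norm (f (proj {M..} x))"
      using add[OF mem] norm_triangle_ineq by simp
    moreover have "norm (f (proj {M..} x)) < norm (f (proj {m..} x)) - e * nrm (ell p) x"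
    proof -
      have "norm (f (proj {M..} x)) \<le> C * nrm (ell p) (proj {M..} x)" by (rule bound[OF mem(2)])
      also have "\<dots> \<le> \<bar>C\<bar> * g" using M by (intro mult_mono) auto
      also have "\<dots> < (1 + \<bar>C\<bar>) * g" using \<open>0 < g\<close> by simp
      also have "\<dots> = norm (f (proj {m..} x)) - e * nrm (ell p) x" by (simp add: g_def)
      finally show ?thesis .
    qed
    moreover have "e * nrm (ell p) y \<le> e * nrm (ell p) x"
      unfolding y_def using e p0 x by (intro mult_left_mono nrm_proj_le) auto
    ultimately have fy: "norm (f y) > e * nrm (ell p) y" by linarith
    then have "norm (f y) > 0" using e by (smt (verit) mult_nonneg_nonneg nrm_ell_nonneg)
    then have "f y \<noteq> 0" by simp
    show ?thesis
    proof (intro exI conjI)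
      show "scl (1 / f y) y \<in> vecs (ell p)" by (intro scl_mem mem)
      show "f (scl (1 / f y) y) = 1" using scl[OF mem(1)] \<open>f y \<noteq> 0\<close> by simp
      show "nrm (ell p) (scl (1 / f y) y) \<le> 1 / e"
        using nrm_scl[OF mem(1)] fy e \<open>norm (f y) > 0\<close> by (simp add: norm_divide field_simps)
      show "\<forall>i. i < m \<or> M \<le> i \<longrightarrow> scl (1 / f y) y i = 0" by (auto simp: scl_def y_def proj_def)
    qed
  qed
  \<comment> \<open>Each new block starts where the support of the sum so far ends, so the \<open>p\<close>-th powers of the
    norms add up.\<close>
  have hump: "\<exists>M y. y \<in> vecs (ell p) \<and> (\<forall>i\<ge>M. y i = 0) \<and> f y = of_nat N \<and>
      nrm (ell p) y powr p \<le> real N * (1 / e) powr p" for N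
  proof (induction N)
    case 0
    have "f 0 = 0" using scl[of 0 0] by simp
    then show ?case using p0 by (intro exI[of _ 0] exI[of _ "0 :: nat \<Rightarrow> 'k"])
      (simp del: zero_fun_apply, simp)
  next
    case (Suc N)
    then obtain m y where y: "y \<in> vecs (ell p)" "\<forall>i\<ge>m. y i = 0" "f y = of_nat N"
      "nrm (ell p) y powr p \<le> real N * (1 / e) powr p" by blast
    obtain M z where z: "z \<in> vecs (ell p)" "\<forall>i. i < m \<or> M \<le> i \<longrightarrow> z i = 0" "f z = 1"
      "nrm (ell p) z \<le> 1 / e" using block[of m] by blast
    show ?case
    proof (intro exI conjI)
      show "y + z \<in> vecs (ell p)" by (intro add_mem y z)
      show "\<forall>i\<ge>max m M. (y + z) i = 0" using y z by simp
      show "f (y + z) = of_nat (Suc N)" using add[OF y(1) z(1)] y z by simp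
      have "y i = 0 \<or> z i = 0" for i using y(2) z(2) by (meson linorder_not_less)
      then have "nrm (ell p) (y + z) powr p \<le> nrm (ell p) y powr p + nrm (ell p) z powr p"
        by (intro nrm_disjoint_add_powr_le p0 y z)
      moreover have "nrm (ell p) z powr p \<le> (1 / e) powr p"
        using z p0 by (intro powr_mono2) auto
      ultimately show "nrm (ell p) (y + z) powr p \<le> real (Suc N) * (1 / e) powr p"
        using y(4) by (simp add: algebra_simps)
    qed
  qed
  \<comment> \<open>Boundedness would give \<open>N powr (p - 1) \<le> K\<close> for every \<open>N\<close>.\<close>
  define K where "K = (\<bar>C\<bar> / e) powr p"
  obtain N :: nat where N: "real N > 1 + K powr (1 / (p - 1))" using reals_Archimedean2 by blast
  obtain M y where y: "y \<in> vecs (ell p)" "f y = of_nat N"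
    "nrm (ell p) y powr p \<le> real N * (1 / e) powr p" using hump[of N] by blast
  have N0: "real N > 0" using N by (smt (verit) powr_ge_zero)
  have "real N \<le> \<bar>C\<bar> * nrm (ell p) y"
  proof -
    have "real N = norm (f y)" by (simp add: y)
    also have "\<dots> \<le> C * nrm (ell p) y" by (rule bound[OF y(1)])
    also have "\<dots> \<le> \<bar>C\<bar> * nrm (ell p) y" by (intro mult_right_mono) auto
    finally show ?thesis .
  qed
  then have "real N powr p \<le> (\<bar>C\<bar> * nrm (ell p) y) powr p" using p0 by (intro powr_mono2) auto
  also have "\<dots> = \<bar>C\<bar> powr p * nrm (ell p) y powr p" by (simp add: powr_mult)
  also have "\<dots> \<le> \<bar>C\<bar> powr p * (real N * (1 / e) powr p)" by (intro mult_left_mono y) simp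
  also have "\<dots> = real N * K" by (simp add: K_def powr_divide)
  finally have "real N powr (p - 1) \<le> K" using N0 by (simp add: powr_diff field_simps)
  then have "(real N powr (p - 1)) powr (1 / (p - 1)) \<le> K powr (1 / (p - 1))"
    using p by (intro powr_mono2) auto
  then have "real N \<le> K powr (1 / (p - 1))" using p N0 by (simp add: powr_powr)
  with N show False by simp
qed

lemma proj_lessThan_Suc:
  "proj {..<Suc k} x = proj {..<k} x + scl (x k) (\<lambda>i. if i = k then 1 else 0)"
  by (auto simp: proj_def scl_def fun_eq_iff less_Suc_eq)

lemma unit_vector_mem:
  assumes "0 < p"
  shows "(\<lambda>i. if i = k then 1 else 0 :: 'k::real_normed_field) \<in> vecs (ell p)" (is "?u \<in> _")
    and "nrm (ell p) (\<lambda>i. if i = k then 1 else 0 :: 'k) \<le> 1"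
proof -
  have "(\<Sum>n<M. norm (?u n) powr p) \<le> 1 powr p" for M
  proof -
    have "(\<Sum>n<M. norm (?u n) powr p) = (\<Sum>n<M. if n = k then 1 else 0)"
      by (intro sum.cong) auto
    then show ?thesis by simp
  qed
  from ell_boundI[OF assms _ this]
  show "?u \<in> vecs (ell p)" and "nrm (ell p) ?u \<le> 1" by auto
qed

text \<open>
  Each row of the matrix of \<open>B\<close> is a bounded functional, so \<open>functional_tail_small\<close> applies to the
  first \<open>k\<close> rows one after the other.
\<close>

lemma rows_almost_finite:
  fixes B :: "(nat \<Rightarrow> 'k::real_normed_field) \<Rightarrow> (nat \<Rightarrow> 'k)"
  assumes p: "1 < p" and r: "1 \<le> r" and B: "B \<in> bounded_ops (ell p) (ell r)" and e: "0 < e"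
  shows "\<forall>\<^sub>F m in sequentially. \<forall>x\<in>vecs (ell p).
    nrm (ell r) (proj {..<k} (B (proj {m..} x))) \<le> e * nrm (ell p) x"
  using e
proof (induction k arbitrary: e)
  case 0
  interpret R: normed_carrier "ell r :: (nat, 'k) nspace" by (rule normed_carrier_ell[OF r])
  \<comment> \<open>The rule \<open>zero_fun_apply\<close> would turn the zero vector into an abstraction, to which
    \<open>nrm_zero\<close> does not apply.\<close>
  show ?case using 0 by (simp del: zero_fun_apply)
next
  case (Suc k)
  interpret R: normed_carrier "ell r :: (nat, 'k) nspace" by (rule normed_carrier_ell[OF r])
  have p0: "0 < p" and r0: "0 < r" using p r by auto
  obtain C where C: "C > 0" "\<And>x. x \<in> vecs (ell p) \<Longrightarrow> nrm (ell r) (B x) \<le> C * nrm (ell p) x"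
    using bounded_ops_bound[OF B] nrm_ell_nonneg by blast
  have "\<exists>m. \<forall>x\<in>vecs (ell p). norm (B (proj {m..} x) k) \<le> e / 2 * nrm (ell p) x"
  proof (rule functional_tail_small[OF p, where C = C])
    show "norm (B x k) \<le> C * nrm (ell p) x" if "x \<in> vecs (ell p)" for x
      using norm_coord_le[OF r0 bounded_ops_mem[OF B that], of k] C(2)[OF that] by linarith
    show "B (x + y) k = B x k + B y k" if "x \<in> vecs (ell p)" "y \<in> vecs (ell p)" for x y
      unfolding bounded_ops_add[OF B that] by simp
    show "B (scl c x) k = c * B x k" if "x \<in> vecs (ell p)" for c x
      unfolding bounded_ops_scl[OF B that] by (simp add: scl_def)
  qed (use Suc.prems in simp)
  then obtain m0 where m0: "\<And>x. x \<in> vecs (ell p) \<Longrightarrow>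
      norm (B (proj {m0..} x) k) \<le> e / 2 * nrm (ell p) x" by blast
  have ev: "\<forall>\<^sub>F m in sequentially. \<forall>x\<in>vecs (ell p).
      nrm (ell r) (proj {..<k} (B (proj {m..} x))) \<le> e / 2 * nrm (ell p) x"
    using Suc.prems by (intro Suc.IH) simp
  from ev eventually_ge_at_top[of m0] show ?case
  proof eventually_elim
    case (elim m)
    show ?case
    proof
      fix x :: "nat \<Rightarrow> 'k" assume x: "x \<in> vecs (ell p)"
      define y where "y = B (proj {m..} x)"
      let ?u = "\<lambda>i. if i = k then 1 else 0 :: 'k"
      have y: "y \<in> vecs (ell r)"
        unfolding y_def by (intro bounded_ops_mem[OF B] proj_mem p0 x)
      have "proj {m0..} (proj {m..} x) = proj {m..} x"
        using elim(2) by (simp add: proj_proj Int_absorb1)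
      then have "norm (y k) \<le> e / 2 * nrm (ell p) (proj {m..} x)"
        unfolding y_def using m0[OF proj_mem[OF p0 x], of "{m..}"] by simp
      also have "\<dots> \<le> e / 2 * nrm (ell p) x"
        using Suc.prems by (intro mult_left_mono nrm_proj_le p0 x) simp
      finally have yk: "norm (y k) \<le> e / 2 * nrm (ell p) x" .
      have "nrm (ell r) (proj {..<Suc k} y) \<le> nrm (ell r) (proj {..<k} y) + nrm (ell r) (scl (y k) ?u)"
        unfolding proj_lessThan_Suc
        by (intro R.nrm_triangle R.scl_mem proj_mem unit_vector_mem r0 y)
      also have "nrm (ell r) (scl (y k) ?u) \<le> norm (y k) * 1"
        unfolding R.nrm_scl[OF unit_vector_mem(1)[OF r0]]
        by (intro mult_left_mono unit_vector_mem r0) simp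
      finally show "nrm (ell r) (proj {..<Suc k} (B (proj {m..} x))) \<le> e * nrm (ell p) x"
        using elim(1) x yk by (fastforce simp: y_def)
    qed
  qed
qed

text \<open>
  The images of the first \<open>k\<close> unit vectors are vectors of the target space and have small tails.
\<close>

lemma columns_almost_finite:
  fixes B :: "(nat \<Rightarrow> 'k::real_normed_field) \<Rightarrow> (nat \<Rightarrow> 'k)"
  assumes p: "1 \<le> p" and r: "1 \<le> r" and B: "B \<in> bounded_ops (ell p) (ell r)" and e: "0 < e"
  shows "\<forall>\<^sub>F m in sequentially. \<forall>x\<in>vecs (ell p).
    nrm (ell r) (proj {m..} (B (proj {..<k} x))) \<le> e * nrm (ell p) x"
  using e
proof (induction k arbitrary: e)
  case 0
  interpret R: normed_carrier "ell r :: (nat, 'k) nspace" by (rule normed_carrier_ell[OF r])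
  show ?case using 0 by (simp add: bounded_ops_zero_arg[OF B] del: zero_fun_apply)
next
  case (Suc k)
  interpret P: normed_carrier "ell p :: (nat, 'k) nspace" by (rule normed_carrier_ell[OF p])
  interpret R: normed_carrier "ell r :: (nat, 'k) nspace" by (rule normed_carrier_ell[OF r])
  have p0: "0 < p" and r0: "0 < r" using p r by auto
  let ?u = "\<lambda>i. if i = k then 1 else 0 :: 'k"
  have u: "?u \<in> vecs (ell p)" by (rule unit_vector_mem[OF p0])
  have "\<forall>\<^sub>F m in sequentially. nrm (ell r) (proj {m..} (B ?u)) \<le> e / 2"
    using Suc.prems by (intro nrm_tail_small r0 bounded_ops_mem[OF B u]) simp
  moreover have "\<forall>\<^sub>F m in sequentially. \<forall>x\<in>vecs (ell p).
      nrm (ell r) (proj {m..} (B (proj {..<k} x))) \<le> e / 2 * nrm (ell p) x"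
    using Suc.prems by (intro Suc.IH) simp
  ultimately show ?case
  proof eventually_elim
    case (elim m)
    show ?case
    proof
      fix x :: "nat \<Rightarrow> 'k" assume x: "x \<in> vecs (ell p)"
      have "B (proj {..<Suc k} x) = B (proj {..<k} x) + scl (x k) (B ?u)"
        unfolding proj_lessThan_Suc
        using bounded_ops_add[OF B proj_mem[OF p0 x] P.scl_mem[OF u]] bounded_ops_scl[OF B u]
        by simp
      then have "proj {m..} (B (proj {..<Suc k} x)) =
          proj {m..} (B (proj {..<k} x)) + scl (x k) (proj {m..} (B ?u))"
        by (simp only: proj_add proj_scl)
      moreover have mem: "proj {m..} (B ?u) \<in> vecs (ell r)" 
        by (intro proj_mem r0 bounded_ops_mem[OF B u])
      ultimately have "nrm (ell r) (proj {m..} (B (proj {..<Suc k} x))) \<le>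
          nrm (ell r) (proj {m..} (B (proj {..<k} x))) + nrm (ell r) (scl (x k) (proj {m..} (B ?u)))"
        by (metis R.nrm_triangle R.scl_mem proj_mem r0 p0 x bounded_ops_mem[OF B])
      also have "nrm (ell r) (scl (x k) (proj {m..} (B ?u))) \<le> nrm (ell p) x * (e / 2)"
        unfolding R.nrm_scl[OF mem] using elim(1)
        by (intro mult_mono norm_coord_le p0 x) auto
      finally show "nrm (ell r) (proj {m..} (B (proj {..<Suc k} x))) \<le> e * nrm (ell p) x"
        using elim(2) x by (fastforce simp: algebra_simps)
    qed
  qed
qed

section \<open>The direct sums of finite-dimensional Hilbert spaces\<close>

text \<open>
  The representative that \<^const>\<open>bounded_ops\<close> prescribes for an operator given by a formula on the
  carrier.
\<close>

definition on_carrier ::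
  "('i, 'k::real_normed_field) nspace \<Rightarrow> (('i \<Rightarrow> 'k) \<Rightarrow> ('j \<Rightarrow> 'k)) \<Rightarrow> (('i \<Rightarrow> 'k) \<Rightarrow> ('j \<Rightarrow> 'k))" where
  "on_carrier X T = (\<lambda>x. if x \<in> vecs X then T x else 0)"

lemma on_carrier_bounded_ops:
  assumes X: "normed_carrier X"
    and "\<And>x. x \<in> vecs X \<Longrightarrow> T x \<in> vecs Y"
    and "\<And>x y. x \<in> vecs X \<Longrightarrow> y \<in> vecs X \<Longrightarrow> T (x + y) = T x + T y"
    and "\<And>c x. x \<in> vecs X \<Longrightarrow> T (scl c x) = scl c (T x)"
    and "\<And>x. x \<in> vecs X \<Longrightarrow> nrm Y (T x) \<le> C * nrm X x"
  shows "on_carrier X T \<in> bounded_ops X Y"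
proof -
  interpret normed_carrier X by fact
  show ?thesis
    using assms(2-)
    by (intro bounded_opsI[where C = C]) (simp_all add: on_carrier_def add_mem scl_mem)
qed

definition slice :: "(nat \<times> nat \<Rightarrow> 'k) \<Rightarrow> nat \<Rightarrow> (nat \<Rightarrow> 'k)" where
  "slice x n = (\<lambda>i. x (n, i))"

text \<open>
  The norms of the summands, as a real sequence. Membership and norm in the direct sum are those of
  this sequence in \<open>ell r\<close>, so the facts on \<open>ell r\<close> carry over.
\<close>

definition slice_norms :: "(nat \<times> nat \<Rightarrow> 'k::real_normed_field) \<Rightarrow> nat \<Rightarrow> real" where
  "slice_norms x = (\<lambda>n. nrm (ell 2) (slice x n))"

lemma slice_add: "slice (x + y) n = slice x n + slice y n"
  by (simp add: slice_def fun_eq_iff)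

lemma slice_scl: "slice (scl c x) n = scl c (slice x n)"
  by (simp add: slice_def scl_def)

lemma slice_norms_nonneg [simp]: "0 \<le> slice_norms x n"
  by (simp add: slice_norms_def)

lemma finite_support_ell:
  assumes "0 < p" "finite D" and zero: "\<And>n. n \<notin> D \<Longrightarrow> x n = 0"
  shows "x \<in> vecs (ell p)" and "nrm (ell p) x = (\<Sum>n\<in>D. norm (x n) powr p) powr (1 / p)"
proof -
  have "norm (x n) powr p = 0" if "n \<notin> D" for n using zero[OF that] by simp
  then show "x \<in> vecs (ell p)" and "nrm (ell p) x = (\<Sum>n\<in>D. norm (x n) powr p) powr (1 / p)"
    using \<open>finite D\<close> by (auto simp: ell_mem_iff nrm_ell suminf_finite intro: summable_finite)
qed

lemma nrm_ell2_fin: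
  assumes "\<And>i. n \<le> i \<Longrightarrow> z i = 0"
  shows "nrm (ell2_fin n) z = nrm (ell 2) z"
proof -
  have "nrm (ell 2) z = (\<Sum>i<n. norm (z i) powr 2) powr (1 / 2)"
    using assms by (intro finite_support_ell) auto
  then show ?thesis
    by (simp add: ell2_fin_def L2_set_def powr_half_sqrt sum_nonneg)
qed

lemma nrm_ell2_sum:
  assumes "\<And>n i. n < i \<Longrightarrow> x (n, i) = 0"
  shows "nrm (ell2_sum r) x = nrm (ell r) (slice_norms x)"
proof -
  have "nrm (ell2_fin (Suc n)) (\<lambda>i. x (n, i)) = slice_norms x n" for n
    unfolding slice_norms_def slice_def using assms by (intro nrm_ell2_fin) auto
  then show ?thesis by (simp add: ell2_sum_def direct_sum_def nrm_ell)
qed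

lemma ell2_sum_mem_iff:
  "x \<in> vecs (ell2_sum r) \<longleftrightarrow> (\<forall>n i. n < i \<longrightarrow> x (n, i) = 0) \<and> slice_norms x \<in> vecs (ell r)"
proof (cases "\<forall>n i. n < i \<longrightarrow> x (n, i) = 0")
  case True
  then have "nrm (ell2_fin (Suc n)) (\<lambda>i. x (n, i)) = slice_norms x n" for n
    unfolding slice_norms_def slice_def by (intro nrm_ell2_fin) auto
  with True show ?thesis
    by (simp add: ell2_sum_def direct_sum_def ell_mem_iff) (simp add: ell2_fin_def)
next
  case False
  then obtain n i where "n < i" "x (n, i) \<noteq> 0" by blast
  then have "(\<lambda>i. x (n, i)) \<notin> vecs (ell2_fin (Suc n))"
    using Suc_leI by (fastforce simp: ell2_fin_def)
  with False show ?thesis by (auto simp: ell2_sum_def direct_sum_def)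
qed

lemma nrm_ell2_sum_nonneg [simp]: "0 \<le> nrm (ell2_sum r) x"
  by (simp add: ell2_sum_def direct_sum_def)

lemma ell2_sum_dest:
  assumes "x \<in> vecs (ell2_sum r)"
  shows "n < i \<Longrightarrow> x (n, i) = 0" and "slice_norms x \<in> vecs (ell r)"
    and "nrm (ell2_sum r) x = nrm (ell r) (slice_norms x)"
    and "0 < s \<Longrightarrow> slice x n \<in> vecs (ell s)"
proof -
  show *: "x (n, i) = 0" if "n < i" for n i using assms that by (auto simp: ell2_sum_mem_iff)
  show "slice_norms x \<in> vecs (ell r)" using assms by (auto simp: ell2_sum_mem_iff)
  show "nrm (ell2_sum r) x = nrm (ell r) (slice_norms x)" by (rule nrm_ell2_sum) (rule *)
  show "slice x n \<in> vecs (ell s)" if "0 < s"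
    using * that by (intro finite_support_ell[of s "{..n}"]) (auto simp: slice_def)
qed

lemma ell2_sum_boundI:
  assumes "0 < r" "0 \<le> c" and supp: "\<And>n i. n < i \<Longrightarrow> x (n, i) = 0"
    and le: "\<And>M. (\<Sum>n<M. slice_norms x n powr r) \<le> c powr r"
  shows "x \<in> vecs (ell2_sum r)" and "nrm (ell2_sum r) x \<le> c"
  using ell_boundI[of r c "slice_norms x"] assms by (auto simp: ell2_sum_mem_iff nrm_ell2_sum)

lemma normed_carrier_ell2_sum:
  assumes r: "1 \<le> r"
  shows "normed_carrier (ell2_sum r :: (nat \<times> nat, 'k::real_normed_field) nspace)"
proof
  interpret R: normed_carrier "ell r :: (nat, real) nspace" by (rule normed_carrier_ell[OF r])
  interpret H: normed_carrier "ell 2 :: (nat, 'k) nspace" by (rule normed_carrier_ell) simp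
  fix x y :: "nat \<times> nat \<Rightarrow> 'k" and c :: 'k
  have r0: "0 < r" using r by simp
  have slice0: "slice (0 :: nat \<times> nat \<Rightarrow> 'k) n = 0" for n by (simp add: slice_def fun_eq_iff)
  have "slice_norms (0 :: nat \<times> nat \<Rightarrow> 'k) = 0"
    unfolding slice_norms_def slice0 H.nrm_zero by (simp add: fun_eq_iff)
  with R.zero_mem show "0 \<in> vecs (ell2_sum r :: (nat \<times> nat, 'k) nspace)"
    unfolding ell2_sum_mem_iff by simp
  show "0 \<le> nrm (ell2_sum r) x" by simp
  {
    assume x: "x \<in> vecs (ell2_sum r)"
    note x' = ell2_sum_dest[OF x]
    have sx: "slice x n \<in> vecs (ell 2)" for n by (rule x') simp
    have eq: "slice_norms (scl c x) = scl (norm c) (slice_norms x)"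
      unfolding slice_norms_def slice_scl H.nrm_scl[OF sx] by (simp add: scl_def)
    have supp: "scl c x (n, i) = 0" if "n < i" for n i using x'(1)[OF that] by (simp add: scl_def)
    show "scl c x \<in> vecs (ell2_sum r)"
      using supp R.scl_mem[OF x'(2)] by (simp add: ell2_sum_mem_iff eq)
    have "nrm (ell2_sum r) (scl c x) = nrm (ell r) (slice_norms (scl c x))"
      by (rule nrm_ell2_sum) (rule supp)
    then show "nrm (ell2_sum r) (scl c x) = norm c * nrm (ell2_sum r) x"
      using R.nrm_scl[OF x'(2)] by (simp add: eq x'(3))
    assume y: "y \<in> vecs (ell2_sum r)"
    note y' = ell2_sum_dest[OF y]
    have sy: "slice y n \<in> vecs (ell 2)" for n by (rule y') simp
    have le: "norm (slice_norms (x + y) n) \<le> norm ((slice_norms x + slice_norms y) n)" for n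
      using H.nrm_triangle[OF sx sy, of n n]
      by (simp add: slice_norms_def slice_add del: plus_fun_apply) simp
    note dom = ell_dominated[OF r0 R.add_mem[OF x'(2) y'(2)] le]
    have supp: "(x + y) (n, i) = 0" if "n < i" for n i using x'(1) y'(1) that by simp
    show "x + y \<in> vecs (ell2_sum r)" unfolding ell2_sum_mem_iff using supp dom(1) by blast
    have "nrm (ell2_sum r) (x + y) = nrm (ell r) (slice_norms (x + y))"
      by (rule nrm_ell2_sum) (rule supp)
    then show "nrm (ell2_sum r) (x + y) \<le> nrm (ell2_sum r) x + nrm (ell2_sum r) y"
      unfolding x'(3) y'(3)
      using dom(2) R.nrm_triangle[OF x'(2) y'(2)] by linarith
  }
qed

lemma formal_identity_eq: "formal_identity r = on_carrier (ell2_sum r) (\<lambda>x. x)"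
  by (simp add: formal_identity_def on_carrier_def fun_eq_iff)

lemma ell2_sum_mono_exponent:
  assumes "0 < r" "r \<le> s" and x: "x \<in> vecs (ell2_sum r)"
  shows "x \<in> vecs (ell2_sum s)" and "nrm (ell2_sum s) x \<le> nrm (ell2_sum r) x"
  using ell_mono_exponent[OF assms(1,2), of "slice_norms x"] x
  by (auto simp: ell2_sum_mem_iff nrm_ell2_sum)

lemma formal_identity_bounded_ops:
  assumes "1 \<le> r" "r \<le> s"
  shows "formal_identity r \<in> bounded_ops (ell2_sum r) (ell2_sum s)"
  unfolding formal_identity_eq using assms ell2_sum_mono_exponent[of r s]
  by (intro on_carrier_bounded_ops[where C = 1] normed_carrier_ell2_sum) auto

text \<open>
  The \<open>2\<close>-sum sits in \<open>ell 2\<close> by numbering its coordinates with \<^const>\<open>prod_encode\<close>. The numbers of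
  pairs \<open>(n, i)\<close> with \<open>n < i\<close> are left over; \<open>unflatten\<close> ignores the coordinates there.
\<close>

definition flatten :: "(nat \<times> nat \<Rightarrow> 'k) \<Rightarrow> (nat \<Rightarrow> 'k)" where
  "flatten x = (\<lambda>m. x (prod_decode m))"

definition unflatten :: "(nat \<Rightarrow> 'k::zero) \<Rightarrow> (nat \<times> nat \<Rightarrow> 'k)" where
  "unflatten z = (\<lambda>(n, i). if i \<le> n then z (prod_encode (n, i)) else 0)"

lemma unflatten_flatten: "x \<in> vecs (ell2_sum r) \<Longrightarrow> unflatten (flatten x) = x"
  by (auto simp: unflatten_def flatten_def fun_eq_iff ell2_sum_mem_iff)

lemma flatten_bounded_ops: "on_carrier (ell2_sum 2) flatten \<in> bounded_ops (ell2_sum 2) (ell 2)"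
proof -
  have bound: "flatten x \<in> vecs (ell 2) \<and> nrm (ell 2) (flatten x) \<le> 1 * nrm (ell2_sum 2) x"
    if x: "x \<in> vecs (ell2_sum 2)" for x :: "nat \<times> nat \<Rightarrow> 'a"
  proof -
    note x' = ell2_sum_dest[OF x]
    have "(\<Sum>m<M. norm (flatten x m) powr 2) \<le> nrm (ell2_sum 2) x powr 2" for M
    proof -
      have "(\<Sum>m<M. norm (flatten x m) powr 2) = (\<Sum>d\<in>prod_decode ` {..<M}. norm (x d) powr 2)"
        unfolding flatten_def by (simp add: sum.reindex inj_prod_decode)
      also have "\<dots> \<le> (\<Sum>d\<in>{..<M} \<times> {..<M}. norm (x d) powr 2)"
      proof (rule sum_mono2)
        show "prod_decode ` {..<M} \<subseteq> {..<M} \<times> {..<M}"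
        proof
          fix d assume "d \<in> prod_decode ` {..<M}"
          then have "prod_encode d < M" by auto
          then show "d \<in> {..<M} \<times> {..<M}"
            using le_prod_encode_1[of "fst d" "snd d"] le_prod_encode_2[of "snd d" "fst d"]
            by (cases d) auto
        qed
      qed auto
      also have "\<dots> = (\<Sum>n<M. \<Sum>i<M. norm (slice x n i) powr 2)"
        by (simp add: sum.cartesian_product slice_def case_prod_unfold)
      also have "\<dots> \<le> (\<Sum>n<M. norm (slice_norms x n) powr 2)"
      proof (rule sum_mono)
        fix n
        have "(\<Sum>i<M. norm (slice x n i) powr 2) \<le> nrm (ell 2) (slice x n) powr 2"
          by (intro ell_sum_le x'(4)) auto
        then show "(\<Sum>i<M. norm (slice x n i) powr 2) \<le> norm (slice_norms x n) powr 2"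
          by (simp add: slice_norms_def)
      qed
      also have "\<dots> \<le> nrm (ell2_sum 2) x powr 2"
        unfolding x'(3) by (intro ell_sum_le x'(2)) auto
      finally show ?thesis .
    qed
    note b = ell_boundI[OF _ _ this]
    have "flatten x \<in> vecs (ell 2)" by (rule b) auto
    moreover have "nrm (ell 2) (flatten x) \<le> nrm (ell2_sum 2) x" by (rule b) auto
    ultimately show ?thesis by simp
  qed
  show ?thesis
    by (intro on_carrier_bounded_ops[where C = 1] normed_carrier_ell2_sum)
      (use bound in \<open>auto simp: flatten_def scl_def fun_eq_iff\<close>)
qed

lemma unflatten_bounded_ops: "on_carrier (ell 2) unflatten \<in> bounded_ops (ell 2) (ell2_sum 2)"
proof -
  have bound: "unflatten z \<in> vecs (ell2_sum 2) \<and> nrm (ell2_sum 2) (unflatten z) \<le> 1 * nrm (ell 2) z"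
    if z: "z \<in> vecs (ell 2)" for z :: "nat \<Rightarrow> 'a"
  proof -
    have supp: "unflatten z (n, i) = 0" if "n < i" for n i using that by (simp add: unflatten_def)
    have "(\<Sum>n<N. slice_norms (unflatten z) n powr 2) \<le> nrm (ell 2) z powr 2" for N
    proof -
      have "slice_norms (unflatten z) n powr 2 = (\<Sum>i\<le>n. norm (z (prod_encode (n, i))) powr 2)" for n
      proof -
        have "slice_norms (unflatten z) n =
            (\<Sum>i\<le>n. norm (slice (unflatten z) n i) powr 2) powr (1 / 2)"
          unfolding slice_norms_def
          by (intro finite_support_ell) (auto simp: slice_def unflatten_def)
        also have "\<dots> = (\<Sum>i\<le>n. norm (z (prod_encode (n, i))) powr 2) powr (1 / 2)"
          by (simp add: slice_def unflatten_def)
        finally show ?thesis by (simp add: powr_powr sum_nonneg)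
      qed
      then have "(\<Sum>n<N. slice_norms (unflatten z) n powr 2) =
          (\<Sum>d\<in>Sigma {..<N} (\<lambda>n. {..n}). norm (z (prod_encode d)) powr 2)"
        by (simp add: sum.Sigma case_prod_unfold)
      also have "\<dots> = (\<Sum>m\<in>prod_encode ` Sigma {..<N} (\<lambda>n. {..n}). norm (z m) powr 2)"
        by (simp add: sum.reindex inj_prod_encode)
      also have "\<dots> \<le> nrm (ell 2) z powr 2" by (intro ell_sum_le z) auto
      finally show ?thesis .
    qed
    note b = ell2_sum_boundI[of 2 "nrm (ell 2) z" "unflatten z", OF _ _ supp this]
    have "unflatten z \<in> vecs (ell2_sum 2)" by (rule b) auto
    moreover have "nrm (ell2_sum 2) (unflatten z) \<le> nrm (ell 2) z" by (rule b) auto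
    ultimately show ?thesis by simp
  qed
  show ?thesis
    by (intro on_carrier_bounded_ops[where C = 1] normed_carrier_ell)
      (use bound in \<open>auto simp: unflatten_def scl_def fun_eq_iff\<close>)
qed

lemma formal_identity_factors_through_ell2:
  assumes "1 \<le> p" "p \<le> 2" "2 \<le> q"
  obtains E F where "E \<in> bounded_ops (ell2_sum p) (ell 2)" "F \<in> bounded_ops (ell 2) (ell2_sum q)"
    "formal_identity p = F \<circ> (E :: _ \<Rightarrow> nat \<Rightarrow> 'k::real_normed_field)"
proof
  let ?E = "on_carrier (ell2_sum 2) flatten \<circ> formal_identity p :: _ \<Rightarrow> nat \<Rightarrow> 'k"
  let ?F = "formal_identity 2 \<circ> on_carrier (ell 2) unflatten :: (nat \<Rightarrow> 'k) \<Rightarrow> _"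
  show "?E \<in> bounded_ops (ell2_sum p) (ell 2)"
    using assms
    by (intro bounded_ops_comp[OF formal_identity_bounded_ops flatten_bounded_ops]) auto
  show "?F \<in> bounded_ops (ell 2) (ell2_sum q)"
    using assms
    by (intro bounded_ops_comp[OF unflatten_bounded_ops formal_identity_bounded_ops]) auto
  have "formal_identity p x = (?F \<circ> ?E) x" for x
  proof (cases "x \<in> vecs (ell2_sum p)")
    case True
    then have x: "x \<in> vecs (ell2_sum 2)" using assms ell2_sum_mono_exponent(1)[of p 2 x] by simp
    then have "on_carrier (ell2_sum 2) flatten x \<in> vecs (ell 2)"
      using flatten_bounded_ops bounded_ops_mem by blast
    with x True show ?thesis
      by (simp add: formal_identity_def on_carrier_def unflatten_flatten[OF x])
  next
    case False
    then show ?thesis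
      unfolding comp_apply formal_identity_def
      by (simp only: if_False bounded_ops_zero_arg[OF flatten_bounded_ops]
          bounded_ops_zero_arg[OF unflatten_bounded_ops]
          bounded_ops_zero_arg[OF formal_identity_bounded_ops[of 2 2, unfolded formal_identity_def]])
  qed
  then show "formal_identity p = ?F \<circ> ?E" by blast
qed

section \<open>The operators that factor through the Hilbert space\<close>

text \<open>
  The isomorphism of \<open>ell 2 \<oplus> ell 2\<close> with \<open>ell 2\<close>: one copy on the even numbers, one on the odd
  numbers.
\<close>

definition interleave :: "(nat \<Rightarrow> 'k) \<Rightarrow> (nat \<Rightarrow> 'k) \<Rightarrow> (nat \<Rightarrow> 'k)" where
  "interleave x y = (\<lambda>n. if even n then x (n div 2) else y (n div 2))"

lemma interleave_bound:
  fixes x y :: "nat \<Rightarrow> 'k::real_normed_field"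
  assumes p: "1 \<le> p" and x: "x \<in> vecs (ell p)" and y: "y \<in> vecs (ell p)"
  shows "interleave x y \<in> vecs (ell p)" and "nrm (ell p) (interleave x y) \<le> nrm (ell p) x + nrm (ell p) y"
proof -
  have p0: "0 < p" using p by simp
  interpret P: normed_carrier "ell p :: (nat, 'k) nspace" by (rule normed_carrier_ell[OF p])
  \<comment> \<open>Distributing the entries of \<open>u\<close> over the range of an injection \<open>h\<close> does not increase the norm;
    this is used for the even and for the odd numbers.\<close>
  have spread: "(\<lambda>n. if n \<in> range h then u (inv h n) else 0) \<in> vecs (ell p) \<and>
      nrm (ell p) (\<lambda>n. if n \<in> range h then u (inv h n) else 0) \<le> nrm (ell p) u"
    if h: "inj h" and u: "u \<in> vecs (ell p)" for h and u :: "nat \<Rightarrow> 'k"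
  proof -
    let ?v = "\<lambda>n. if n \<in> range h then u (inv h n) else 0"
    have "(\<Sum>n<M. norm (?v n) powr p) \<le> nrm (ell p) u powr p" for M
    proof -
      have "(\<Sum>n<M. norm (?v n) powr p) = (\<Sum>n\<in>{..<M} \<inter> range h. norm (u (inv h n)) powr p)"
        by (rule sum.mono_neutral_cong_right) auto
      also have "\<dots> = (\<Sum>m\<in>inv h ` ({..<M} \<inter> range h). norm (u m) powr p)"
        by (subst sum.reindex) (auto intro: inj_on_inv_into inj_on_subset)
      also have "\<dots> \<le> nrm (ell p) u powr p" by (intro ell_sum_le p0 u) auto
      finally show ?thesis .
    qed
    from ell_boundI[OF p0 _ this] show ?thesis by auto
  qed
  define dbl :: "nat \<Rightarrow> nat" where "dbl = (\<lambda>n. 2 * n)"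
  define dbl1 :: "nat \<Rightarrow> nat" where "dbl1 = (\<lambda>n. 2 * n + 1)"
  have inj: "inj dbl" "inj dbl1" by (auto simp: dbl_def dbl1_def inj_def)
  have inv: "inv dbl (2 * n) = n" "inv dbl1 (2 * n + 1) = n" for n
    using inv_f_f[OF inj(1), of n] inv_f_f[OF inj(2), of n] by (auto simp: dbl_def dbl1_def)
  define u where "u = (\<lambda>n. if n \<in> range dbl then x (inv dbl n) else 0)"
  define v where "v = (\<lambda>n. if n \<in> range dbl1 then y (inv dbl1 n) else 0)"
  have eq: "interleave x y = u + v"
  proof
    fix n
    show "interleave x y n = (u + v) n"
    proof (cases "even n")
      case True
      then obtain m where n: "n = 2 * m" by (elim evenE)
      have "n \<in> range dbl" "n \<notin> range dbl1" using n by (auto simp: dbl_def dbl1_def) presburger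
      with n show ?thesis by (simp add: interleave_def u_def v_def inv)
    next
      case False
      then obtain m where n: "n = 2 * m + 1" by (elim oddE)
      have "n \<notin> range dbl" "n \<in> range dbl1" using n by (auto simp: dbl_def dbl1_def) presburger
      with n inv(2)[of m] show ?thesis by (simp add: interleave_def u_def v_def)
    qed
  qed
  have u: "u \<in> vecs (ell p)" "nrm (ell p) u \<le> nrm (ell p) x"
    using spread[OF inj(1) x] by (auto simp: u_def)
  have v: "v \<in> vecs (ell p)" "nrm (ell p) v \<le> nrm (ell p) y"
    using spread[OF inj(2) y] by (auto simp: v_def)
  show "interleave x y \<in> vecs (ell p)" unfolding eq by (rule P.add_mem[OF u(1) v(1)])
  show "nrm (ell p) (interleave x y) \<le> nrm (ell p) x + nrm (ell p) y"
    unfolding eq using P.nrm_triangle[OF u(1) v(1)] u(2) v(2) by linarith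
qed

lemma subsequence_bound:
  assumes p: "0 < p" and h: "inj h" and z: "z \<in> vecs (ell p)"
  shows "z \<circ> h \<in> vecs (ell p)" and "nrm (ell p) (z \<circ> h) \<le> nrm (ell p) z"
proof -
  have "(\<Sum>n<M. norm ((z \<circ> h) n) powr p) \<le> nrm (ell p) z powr p" for M
  proof -
    have "(\<Sum>n<M. norm ((z \<circ> h) n) powr p) = (\<Sum>m\<in>h ` {..<M}. norm (z m) powr p)"
      using h by (subst sum.reindex) (auto intro: inj_on_subset)
    also have "\<dots> \<le> nrm (ell p) z powr p" by (intro ell_sum_le p z) auto
    finally show ?thesis .
  qed
  note b = ell_boundI[OF p _ this]
  show "z \<circ> h \<in> vecs (ell p)" by (rule b) simp
  show "nrm (ell p) (z \<circ> h) \<le> nrm (ell p) z" by (rule b) simp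
qed

text \<open>
  With \<open>S = A \<circ> B\<close> and \<open>T = A' \<circ> B'\<close>, the sum first maps \<open>x\<close> to the pair of \<open>B x\<close> and \<open>B' x\<close>, stored
  in one sequence by \<^const>\<open>interleave\<close>, and then adds \<open>A\<close> of the even part and \<open>A'\<close> of the odd part.
\<close>

lemma factors_through_ell2_plus:
  fixes S T :: "('i \<Rightarrow> 'k::real_normed_field) \<Rightarrow> ('j \<Rightarrow> 'k)"
  assumes X: "normed_carrier X" and Y: "normed_carrier Y"
    and "factors_through_ell2 X Y S" "factors_through_ell2 X Y T"
  shows "factors_through_ell2 X Y (S + T)"
proof -
  interpret X: normed_carrier X by fact
  interpret Y: normed_carrier Y by fact
  interpret H: normed_carrier "ell 2 :: (nat, 'k) nspace" by (rule normed_carrier_ell) simp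
  obtain A B where S: "B \<in> bounded_ops X (ell 2)" "A \<in> bounded_ops (ell 2) Y" "S = A \<circ> B"
    using assms(3) unfolding factors_through_ell2_def by blast
  obtain A' B' where T: "B' \<in> bounded_ops X (ell 2)" "A' \<in> bounded_ops (ell 2) Y" "T = A' \<circ> B'"
    using assms(4) unfolding factors_through_ell2_def by blast
  define E where "E = (\<lambda>x. interleave (B x) (B' x))"
  define ev od :: "nat \<Rightarrow> nat" where "ev = (\<lambda>n. 2 * n)" and "od = (\<lambda>n. 2 * n + 1)"
  have inj: "inj ev" "inj od" by (auto simp: ev_def od_def inj_def)
  define F where "F = on_carrier (ell 2) (\<lambda>z. A (z \<circ> ev) + A' (z \<circ> od))"
  have comp: "(x + y) \<circ> h = (x \<circ> h) + (y \<circ> h)" "scl c x \<circ> h = scl c (x \<circ> h)"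
    for x y :: "nat \<Rightarrow> 'k" and c and h :: "nat \<Rightarrow> nat"
    by (simp_all add: fun_eq_iff scl_def)
  have E: "E \<in> bounded_ops X (ell 2)"
  proof -
    obtain C where C: "\<And>x. x \<in> vecs X \<Longrightarrow> nrm (ell 2) (B x) \<le> C * nrm X x"
      using bounded_ops_bound[OF S(1)] X.nrm_nonneg by blast
    obtain C' where C': "\<And>x. x \<in> vecs X \<Longrightarrow> nrm (ell 2) (B' x) \<le> C' * nrm X x"
      using bounded_ops_bound[OF T(1)] X.nrm_nonneg by blast
    show ?thesis
    proof (rule bounded_opsI[where C = "C + C'"])
      fix x y assume x: "x \<in> vecs X"
      note mem = bounded_ops_mem[OF S(1) x] bounded_ops_mem[OF T(1) x]
      show "E x \<in> vecs (ell 2)" unfolding E_def by (intro interleave_bound mem) simp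
      have "nrm (ell 2) (E x) \<le> nrm (ell 2) (B x) + nrm (ell 2) (B' x)"
        unfolding E_def by (intro interleave_bound mem) simp
      with C[OF x] C'[OF x] show "nrm (ell 2) (E x) \<le> (C + C') * nrm X x"
        by (simp add: algebra_simps)
      show "E (scl c x) = scl c (E x)" for c
        unfolding E_def bounded_ops_scl[OF S(1) x] bounded_ops_scl[OF T(1) x]
        by (simp add: interleave_def scl_def fun_eq_iff)
      assume y: "y \<in> vecs X"
      show "E (x + y) = E x + E y"
        unfolding E_def bounded_ops_add[OF S(1) x y] bounded_ops_add[OF T(1) x y]
        by (simp add: interleave_def fun_eq_iff)
    next
      fix x assume x: "x \<notin> vecs X"
      show "E x = 0"
        unfolding E_def bounded_ops_outside[OF S(1) x] bounded_ops_outside[OF T(1) x]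
        by (simp add: interleave_def fun_eq_iff)
    qed
  qed
  have F: "F \<in> bounded_ops (ell 2) Y"
  proof -
    obtain C where C: "C > 0" "\<And>x. x \<in> vecs (ell 2) \<Longrightarrow> nrm Y (A x) \<le> C * nrm (ell 2) x"
      using bounded_ops_bound[OF S(2)] nrm_ell_nonneg by blast
    obtain C' where C': "C' > 0" "\<And>x. x \<in> vecs (ell 2) \<Longrightarrow> nrm Y (A' x) \<le> C' * nrm (ell 2) x"
      using bounded_ops_bound[OF T(2)] nrm_ell_nonneg by blast
    have two: "0 < (2::real)" by simp
    show ?thesis unfolding F_def
    proof (rule on_carrier_bounded_ops[where C = "C + C'"])
      fix x y assume x: "x \<in> vecs (ell 2 :: (nat, 'k) nspace)"
      note x1 = subsequence_bound[OF two inj(1) x] and x2 = subsequence_bound[OF two inj(2) x]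
      note Ax = bounded_ops_mem[OF S(2) x1(1)] bounded_ops_mem[OF T(2) x2(1)]
      show "A (x \<circ> ev) + A' (x \<circ> od) \<in> vecs Y" by (intro Y.add_mem Ax)
      have "nrm Y (A (x \<circ> ev)) \<le> C * nrm (ell 2) x"
        using C(2)[OF x1(1)] x1(2) C(1) by (meson mult_left_mono less_imp_le order_trans)
      moreover have "nrm Y (A' (x \<circ> od)) \<le> C' * nrm (ell 2) x"
        using C'(2)[OF x2(1)] x2(2) C'(1) by (meson mult_left_mono less_imp_le order_trans)
      ultimately show "nrm Y (A (x \<circ> ev) + A' (x \<circ> od)) \<le> (C + C') * nrm (ell 2) x"
        using Y.nrm_triangle[OF Ax] by (simp add: algebra_simps)
      show "A (scl c x \<circ> ev) + A' (scl c x \<circ> od) = scl c (A (x \<circ> ev) + A' (x \<circ> od))" for c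
        unfolding comp bounded_ops_scl[OF S(2) x1(1)] bounded_ops_scl[OF T(2) x2(1)] scl_add ..
      assume y: "y \<in> vecs (ell 2 :: (nat, 'k) nspace)"
      note y1 = subsequence_bound(1)[OF two inj(1) y] and y2 = subsequence_bound(1)[OF two inj(2) y]
      show "A (x + y \<circ> ev) + A' (x + y \<circ> od) =
          A (x \<circ> ev) + A' (x \<circ> od) + (A (y \<circ> ev) + A' (y \<circ> od))"
        unfolding comp bounded_ops_add[OF S(2) x1(1) y1] bounded_ops_add[OF T(2) x2(1) y2]
        by (simp add: add_ac)
    qed (rule H.normed_carrier_axioms)
  qed
  have "(S + T) x = (F \<circ> E) x" for x
  proof (cases "x \<in> vecs X")
    case True
    then have "E x \<in> vecs (ell 2)" using bounded_ops_mem[OF E] by simp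
    moreover have "E x \<circ> ev = B x" "E x \<circ> od = B' x"
      by (auto simp: E_def interleave_def ev_def od_def fun_eq_iff)
    ultimately show ?thesis by (simp add: F_def on_carrier_def S T)
  next
    case False
    then show ?thesis
      using bounded_ops_outside[OF E False] bounded_ops_zero_arg[OF F]
        bounded_ops_outside[OF S(1) False] bounded_ops_outside[OF T(1) False]
        bounded_ops_zero_arg[OF S(2)] bounded_ops_zero_arg[OF T(2)]
      by (simp add: S T del: zero_fun_apply)
  qed
  then have "S + T = F \<circ> E" by (rule ext)
  with E F show ?thesis unfolding factors_through_ell2_def by blast
qed

lemma op_ideal_factors_through_ell2:
  assumes X: "normed_carrier X" and Y: "normed_carrier Y"
  shows "op_ideal X Y {S \<in> bounded_ops X Y. factors_through_ell2 X Y S}" (is "op_ideal X Y ?F")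
  unfolding op_ideal_def
proof (intro conjI ballI allI)
  interpret X: normed_carrier X by fact
  interpret Y: normed_carrier Y by fact
  have H: "normed_carrier (ell 2 :: (nat, 'b) nspace)" by (rule normed_carrier_ell) simp
  show "?F \<subseteq> bounded_ops X Y" by blast
  have "factors_through_ell2 X Y 0"
    unfolding factors_through_ell2_def
    by (intro bexI[of _ 0] bounded_ops_zero X Y H) (simp add: fun_eq_iff)
  then show "0 \<in> ?F" using bounded_ops_zero[OF X Y] by simp
  show "S + T \<in> ?F" if "S \<in> ?F" "T \<in> ?F" for S T
    using that factors_through_ell2_plus[OF X Y] bounded_ops_plus[OF X Y] by blast
  show "(\<lambda>x. scl c (S x)) \<in> ?F" if S: "S \<in> ?F" for c S
  proof -
    obtain A B where AB: "B \<in> bounded_ops X (ell 2)" "A \<in> bounded_ops (ell 2) Y" "S = A \<circ> B"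
      using S unfolding factors_through_ell2_def by blast
    have "(\<lambda>x. scl c (S x)) = (\<lambda>z. scl c (A z)) \<circ> B" by (simp add: AB fun_eq_iff)
    then have "factors_through_ell2 X Y (\<lambda>x. scl c (S x))"
      unfolding factors_through_ell2_def using AB bounded_ops_scale[OF Y] by blast
    with S bounded_ops_scale[OF Y] show ?thesis by blast
  qed
  show "A \<circ> S \<circ> B \<in> ?F"
    if A: "A \<in> bounded_ops Y Y" and S: "S \<in> ?F" and B: "B \<in> bounded_ops X X" for A S B
  proof -
    obtain A' B' where AB: "B' \<in> bounded_ops X (ell 2)" "A' \<in> bounded_ops (ell 2) Y" "S = A' \<circ> B'"
      using S unfolding factors_through_ell2_def by blast
    have "A \<circ> A' \<in> bounded_ops (ell 2) Y" "B' \<circ> B \<in> bounded_ops X (ell 2)"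
      by (intro bounded_ops_comp[OF AB(2) A] bounded_ops_comp[OF B AB(1)]; simp)+
    moreover from this have "(A \<circ> A') \<circ> (B' \<circ> B) \<in> bounded_ops X Y"
      by (intro bounded_ops_comp[where Y = "ell 2"]) auto
    moreover have "A \<circ> S \<circ> B = (A \<circ> A') \<circ> (B' \<circ> B)" by (simp add: AB comp_assoc)
    ultimately show ?thesis unfolding factors_through_ell2_def by auto
  qed
qed

section \<open>Approximating a product by a block sum\<close>

lemma sum_fun_eval: "(\<Sum>i\<in>F. f i) n = (\<Sum>i\<in>F. f i n)"
  for f :: "'i \<Rightarrow> 'a \<Rightarrow> 'b::comm_monoid_add"
  by (induction F rule: infinite_finite_induct) auto

lemma nrm_le_if_truncations_le:
  assumes p: "0 < p" and z: "z \<in> vecs (ell p)" and "0 \<le> c"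
    and le: "\<And>M. nrm (ell p) (proj {..<M} z) \<le> c"
  shows "nrm (ell p) z \<le> c"
proof (rule ell_boundI(2)[OF p \<open>0 \<le> c\<close>])
  fix M
  have "(\<Sum>n<M. norm (z n) powr p) = (\<Sum>n<M. norm (proj {..<M} z n) powr p)"
    by (simp add: proj_apply)
  also have "\<dots> \<le> nrm (ell p) (proj {..<M} z) powr p"
    by (intro ell_sum_le p proj_mem z) simp
  also have "\<dots> \<le> c powr p" using p le by (intro powr_mono2) auto
  finally show "(\<Sum>n<M. norm (z n) powr p) \<le> c powr p" .
qed

text \<open>
  A sum of at most three terms is at most three times the largest one.
\<close>

lemma sum_powr_le_three:
  fixes a :: "'a \<Rightarrow> real"
  assumes "finite F" "card F \<le> 3" and nonneg: "\<And>i. i \<in> F \<Longrightarrow> 0 \<le> a i" and q: "0 < q"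
  shows "(\<Sum>i\<in>F. a i) powr q \<le> 3 powr q * (\<Sum>i\<in>F. a i powr q)"
proof (cases "F = {}")
  case False
  with \<open>finite F\<close> have "Max (a ` F) \<in> a ` F" by simp
  then obtain j where j: "j \<in> F" "\<And>i. i \<in> F \<Longrightarrow> a i \<le> a j"
    using \<open>finite F\<close> by (metis (no_types, lifting) Max_ge finite_imageI imageE imageI)
  have "(\<Sum>i\<in>F. a i) \<le> real (card F) * a j" by (rule sum_bounded_above) (rule j)
  also have "\<dots> \<le> 3 * a j" using assms j by (intro mult_right_mono) auto
  finally have "(\<Sum>i\<in>F. a i) powr q \<le> (3 * a j) powr q"
    using q nonneg by (intro powr_mono2 sum_nonneg) auto
  also have "\<dots> = 3 powr q * a j powr q" by (simp add: powr_mult)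
  also have "\<dots> \<le> 3 powr q * (\<Sum>i\<in>F. a i powr q)"
    using j \<open>finite F\<close> by (intro mult_left_mono member_le_sum) auto
  finally show ?thesis .
qed simp

text \<open>
  A division of the coordinates into consecutive finite blocks. A window is a block together with
  its two neighbours; the truncated subtraction makes the window of the first block start at
  \<open>k 0 = 0\<close>. The number \<open>slot i\<close> is that of the summand of the direct sum which is to hold the \<open>i\<close>-th
  block: it is at least every coordinate of the block, so the block fits in without renumbering.
\<close>

locale blocking =
  fixes k :: "nat \<Rightarrow> nat"
  assumes k0: "k 0 = 0" and strict_mono_k: "strict_mono k"
begin

definition block :: "nat \<Rightarrow> nat set" where
  "block i = {k i..<k (Suc i)}"

definition window :: "nat \<Rightarrow> nat set" where
  "window i = {k (i - 1)..<k (i + 2)}"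

definition slot :: "nat \<Rightarrow> nat" where
  "slot i = k (Suc i)"

lemma k_le_iff: "k i \<le> k j \<longleftrightarrow> i \<le> j"
  using strict_mono_k by (simp add: strict_mono_less_eq)

lemma le_k: "i \<le> k i"
  using strict_mono_k by (rule strict_mono_imp_increasing)

lemma le_slot: "i \<le> slot i"
  using le_k[of "Suc i"] by (simp add: slot_def)

lemma inj_slot: "inj slot"
  using strict_mono_k by (auto simp: slot_def inj_def strict_mono_eq)

lemma inv_slot [simp]: "inv slot (slot i) = i"
  by (rule inv_f_f[OF inj_slot])

lemma window_index_le:
  assumes "n \<in> window i"
  shows "i \<le> n + 1"
proof -
  have "k (i - 1) \<le> n" using assms by (simp add: window_def)
  with le_k[of "i - 1"] show ?thesis by arith
qed

lemma windows_at:
  shows "finite {i. n \<in> window i}" and "card {i. n \<in> window i} \<le> 3"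
proof -
  show fin: "finite {i. n \<in> window i}"
    by (rule finite_subset[of _ "{..n + 1}"]) (auto dest: window_index_le)
  show "card {i. n \<in> window i} \<le> 3"
  proof (cases "{i. n \<in> window i} = {}")
    case False
    \<comment> \<open>A window of index above \<open>j + 2\<close> starts only after window \<open>j\<close> has ended.\<close>
    define j where "j = Min {i. n \<in> window i}"
    have j: "n \<in> window j" "\<And>i. n \<in> window i \<Longrightarrow> j \<le> i"
      using Min_in[OF fin False] Min_le[OF fin] by (auto simp: j_def)
    have "{i. n \<in> window i} \<subseteq> {j..j + 2}"
    proof
      fix i assume i: "i \<in> {i. n \<in> window i}"
      then have "k (i - 1) < k (j + 2)" using j by (simp add: window_def)
      then have "i \<le> j + 2" using k_le_iff[of "j + 2" "i - 1"] by linarith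
      with i j show "i \<in> {j..j + 2}" by auto
    qed
    from card_mono[OF _ this] show ?thesis by simp
  qed simp
qed

text \<open>
  Exchanging the sums, each coordinate is counted once for every window that contains it.
\<close>

lemma sum_window_powr_le:
  assumes p: "0 < p" and x: "x \<in> vecs (ell p)"
  shows "(\<Sum>i<N. nrm (ell p) (proj (window i) x) powr p) \<le> 3 * nrm (ell p) x powr p"
proof -
  define U where "U = (\<Union>i<N. window i)"
  have U: "finite U" "\<And>i. i < N \<Longrightarrow> window i \<subseteq> U" by (auto simp: U_def window_def)
  have "nrm (ell p) (proj (window i) x) powr p =
      (\<Sum>n\<in>U. if n \<in> window i then norm (x n) powr p else 0)" if "i < N" for i
  proof -
    have "nrm (ell p) (proj (window i) x) = (\<Sum>n\<in>U. norm (proj (window i) x n) powr p) powr (1 / p)"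
      using U that p by (intro finite_support_ell) (auto simp: proj_apply)
    then have "nrm (ell p) (proj (window i) x) powr p = (\<Sum>n\<in>U. norm (proj (window i) x n) powr p)"
      using p by (simp add: powr_powr sum_nonneg)
    also have "\<dots> = (\<Sum>n\<in>U. if n \<in> window i then norm (x n) powr p else 0)"
      by (intro sum.cong) (auto simp: proj_apply)
    finally show ?thesis .
  qed
  then have "(\<Sum>i<N. nrm (ell p) (proj (window i) x) powr p) =
      (\<Sum>i<N. \<Sum>n\<in>U. if n \<in> window i then norm (x n) powr p else 0)"
    by (intro sum.cong) auto
  also have "\<dots> = (\<Sum>n\<in>U. \<Sum>i<N. if n \<in> window i then norm (x n) powr p else 0)"
    by (rule sum.swap)
  also have "\<dots> \<le> (\<Sum>n\<in>U. 3 * norm (x n) powr p)"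
  proof (rule sum_mono)
    fix n
    have "(\<Sum>i<N. if n \<in> window i then norm (x n) powr p else 0) =
        real (card ({..<N} \<inter> {i. n \<in> window i})) * norm (x n) powr p"
      by (simp add: sum.If_cases)
    also have "\<dots> \<le> 3 * norm (x n) powr p"
    proof (rule mult_right_mono)
      have "card ({..<N} \<inter> {i. n \<in> window i}) \<le> card {i. n \<in> window i}"
        by (intro card_mono windows_at) auto
      with windows_at(2)[of n] show "real (card ({..<N} \<inter> {i. n \<in> window i})) \<le> 3" by simp
    qed simp
    finally show "(\<Sum>i<N. if n \<in> window i then norm (x n) powr p else 0) \<le> 3 * norm (x n) powr p" .
  qed
  also have "\<dots> = 3 * (\<Sum>n\<in>U. norm (x n) powr p)" by (simp add: sum_distrib_left)
  also have "\<dots> \<le> 3 * nrm (ell p) x powr p" by (intro mult_left_mono ell_sum_le p x U) simp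
  finally show ?thesis .
qed

text \<open>
  At every coordinate the sum has at most three terms, so the norms of the vectors \<open>u i\<close> combine as
  those of disjointly supported vectors do, up to a factor \<open>3\<close>.
\<close>

lemma window_sum_bound:
  fixes u :: "nat \<Rightarrow> nat \<Rightarrow> 'k::real_normed_field"
  assumes q: "0 < q" and "0 \<le> c" and u: "\<And>i. u i \<in> vecs (ell q)"
    and le: "\<And>N. (\<Sum>i<N. nrm (ell q) (u i) powr q) \<le> c powr q"
  shows "(\<lambda>n. \<Sum>i | n \<in> window i. u i n) \<in> vecs (ell q)" (is "?v \<in> _")
    and "nrm (ell q) (\<lambda>n. \<Sum>i | n \<in> window i. u i n) \<le> 3 * c"
proof -
  have "(\<Sum>n<M. norm (?v n) powr q) \<le> (3 * c) powr q" for M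
  proof -
    have "norm (?v n) powr q \<le> 3 powr q * (\<Sum>i<Suc M. norm (u i n) powr q)" if "n < M" for n
    proof -
      have "norm (?v n) powr q \<le> (\<Sum>i | n \<in> window i. norm (u i n)) powr q"
        using q by (intro powr_mono2 norm_sum) auto
      also have "\<dots> \<le> 3 powr q * (\<Sum>i | n \<in> window i. norm (u i n) powr q)"
        by (intro sum_powr_le_three windows_at q) simp
      also have "\<dots> \<le> 3 powr q * (\<Sum>i<Suc M. norm (u i n) powr q)"
        using that by (intro mult_left_mono sum_mono2) (auto dest: window_index_le)
      finally show ?thesis .
    qed
    then have "(\<Sum>n<M. norm (?v n) powr q) \<le> (\<Sum>n<M. 3 powr q * (\<Sum>i<Suc M. norm (u i n) powr q))"
      by (intro sum_mono) auto
    also have "\<dots> = 3 powr q * (\<Sum>i<Suc M. \<Sum>n<M. norm (u i n) powr q)"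
      unfolding sum_distrib_left[symmetric] by (subst sum.swap) simp
    also have "\<dots> \<le> 3 powr q * (\<Sum>i<Suc M. nrm (ell q) (u i) powr q)"
      by (intro mult_left_mono sum_mono ell_sum_le q u) auto
    also have "\<dots> \<le> 3 powr q * c powr q" by (intro mult_left_mono le) simp
    finally show ?thesis by (simp add: powr_mult)
  qed
  note b = ell_boundI[OF q _ this]
  show "?v \<in> vecs (ell q)" by (rule b) (use \<open>0 \<le> c\<close> in simp)
  show "nrm (ell q) ?v \<le> 3 * c" by (rule b) (use \<open>0 \<le> c\<close> in simp)
qed

definition embed :: "(nat \<Rightarrow> nat \<Rightarrow> 'k) \<Rightarrow> (nat \<times> nat \<Rightarrow> 'k::zero)" where
  "embed u = (\<lambda>(s, l). if s \<in> range slot then u (inv slot s) l else 0)"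

lemma slice_embed: "slice (embed u) (slot i) = u i"
  by (simp add: slice_def embed_def)

lemma embed_bound:
  fixes u :: "nat \<Rightarrow> nat \<Rightarrow> 'k::real_normed_field"
  assumes r: "0 < r" and "0 \<le> c" and supp: "\<And>i l. slot i < l \<Longrightarrow> u i l = 0"
    and le: "\<And>N. (\<Sum>i<N. nrm (ell 2) (u i) powr r) \<le> c powr r"
  shows "embed u \<in> vecs (ell2_sum r)" and "nrm (ell2_sum r) (embed u) \<le> c"
proof -
  have zero: "slice_norms (embed u) s = 0" if "s \<notin> range slot" for s
  proof -
    have "slice (embed u) s = 0" using that by (auto simp: slice_def embed_def fun_eq_iff)
    moreover have "nrm (ell 2) (0 :: nat \<Rightarrow> 'k) = 0" by (simp add: nrm_ell)
    ultimately show ?thesis by (simp add: slice_norms_def del: zero_fun_apply)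
  qed
  have "(\<Sum>s<M. slice_norms (embed u) s powr r) \<le> c powr r" for M
  proof -
    have "(\<Sum>s<M. slice_norms (embed u) s powr r) =
        (\<Sum>s\<in>{..<M} \<inter> range slot. slice_norms (embed u) s powr r)"
      by (rule sum.mono_neutral_right) (auto simp: zero)
    also have "\<dots> \<le> (\<Sum>s\<in>slot ` {..<M}. slice_norms (embed u) s powr r)"
    proof (rule sum_mono2)
      show "{..<M} \<inter> range slot \<subseteq> slot ` {..<M}"
        using le_slot by (auto intro: le_less_trans)
    qed auto
    also have "\<dots> = (\<Sum>i<M. nrm (ell 2) (u i) powr r)"
      using inj_slot by (subst sum.reindex) (auto intro: inj_on_subset simp: slice_norms_def slice_embed)
    also have "\<dots> \<le> c powr r" by (rule le)
    finally show ?thesis .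
  qed
  moreover have "embed u (s, l) = 0" if "s < l" for s l
    using that supp by (auto simp: embed_def)
  ultimately show "embed u \<in> vecs (ell2_sum r)" and "nrm (ell2_sum r) (embed u) \<le> c"
    using ell2_sum_boundI[of r c "embed u"] r \<open>0 \<le> c\<close> by auto
qed

lemma split_sum_blocks:
  fixes x :: "nat \<Rightarrow> 'k::real_normed_field"
  shows "x = (\<Sum>i<N. proj (block i) x) + proj {k N..} x"
proof (induction N)
  case 0
  have "proj {k 0..} x = x" by (simp add: k0 proj_def)
  then show ?case by simp
next
  case (Suc N)
  have "{k N..} = block N \<union> {k (Suc N)..}" "block N \<inter> {k (Suc N)..} = {}"
    using k_le_iff[of N "Suc N"] by (auto simp: block_def)
  then have "proj {k N..} x = proj (block N) x + proj {k (Suc N)..} x"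
    by (metis proj_Un)
  with Suc.IH show ?case by (simp add: add.assoc del: plus_fun_apply)
qed

lemma compl_window: "- window i = {..<k (i - 1)} \<union> {k (i + 2)..}"
  "{..<k (i - 1)} \<inter> {k (i + 2)..} = {}"
  using k_le_iff[of "i - 1" "i + 2"] by (auto simp: window_def)

end

text \<open>
  The entries outside the band of neighbouring blocks are negligible, with errors that are summable
  over the blocks.
\<close>

locale almost_banded = blocking k for k :: "nat \<Rightarrow> nat" +
  fixes p r d :: real and T :: "(nat \<Rightarrow> 'k::real_normed_field) \<Rightarrow> (nat \<Rightarrow> 'k)"
  assumes p: "1 \<le> p" and r: "1 \<le> r" and T: "T \<in> bounded_ops (ell p) (ell r)" and d: "0 \<le> d"
    and below: "\<And>i x. x \<in> vecs (ell p) \<Longrightarrow>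
      nrm (ell r) (proj {k (Suc i)..} (T (proj {..<k i} x))) \<le> d / 2 ^ i * nrm (ell p) x"
    and above: "\<And>i x. x \<in> vecs (ell p) \<Longrightarrow>
      nrm (ell r) (proj {..<k i} (T (proj {k (Suc i)..} x))) \<le> d / 2 ^ i * nrm (ell p) x"
begin

sublocale P: normed_carrier "ell p :: (nat, 'k) nspace" by (rule normed_carrier_ell[OF p])
sublocale R: normed_carrier "ell r :: (nat, 'k) nspace" by (rule normed_carrier_ell[OF r])

lemma pos: "0 < p" "0 < r"
  using p r by auto

lemma T_proj_mem: "x \<in> vecs (ell p) \<Longrightarrow> proj D (T (proj E x)) \<in> vecs (ell r)"
  by (intro proj_mem pos bounded_ops_mem[OF T])

lemma decay_Suc: "0 \<le> N \<Longrightarrow> d / 2 ^ Suc i * N \<le> d / 2 ^ i * N"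
  using d by (intro mult_right_mono divide_left_mono) auto

lemma le_three_times: "a \<le> b + c \<Longrightarrow> b \<le> 2 * t \<Longrightarrow> c \<le> t \<Longrightarrow> a \<le> 3 * t" for a b c t :: real
  by linarith

text \<open>
  The complement of a window is an initial segment, where \<open>below\<close> applies, and a tail, where \<open>above\<close>
  applies. For the initial segment the bound is the one of the preceding index, which is twice as
  large; together this gives the factor \<open>3\<close>.
\<close>

lemma block_row_outside_window:
  assumes x: "x \<in> vecs (ell p)"
  shows "nrm (ell r) (proj (block i) (T (proj (- window i) x))) \<le> 3 * (d / 2 ^ i) * nrm (ell p) x"
proof -
  have "proj (- window i) x = proj {..<k (i - 1)} x + proj {k (i + 2)..} x"
    unfolding compl_window(1) by (rule proj_Un[OF compl_window(2)])
  then have "proj (block i) (T (proj (- window i) x)) =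
      proj (block i) (T (proj {..<k (i - 1)} x)) + proj (block i) (T (proj {k (i + 2)..} x))"
    using bounded_ops_add[OF T proj_mem[OF pos(1) x] proj_mem[OF pos(1) x]] by (simp only: proj_add)
  then have "nrm (ell r) (proj (block i) (T (proj (- window i) x))) \<le>
      nrm (ell r) (proj (block i) (T (proj {..<k (i - 1)} x))) +
      nrm (ell r) (proj (block i) (T (proj {k (i + 2)..} x)))"
    using R.nrm_triangle[OF T_proj_mem[OF x] T_proj_mem[OF x]] by (simp only:)
  moreover have "nrm (ell r) (proj (block i) (T (proj {..<k (i - 1)} x))) \<le> 2 * (d / 2 ^ i) * nrm (ell p) x"
  proof (cases i)
    case 0
    have "nrm (ell r) (proj (block i) (T (proj {..<k (i - 1)} x))) = 0"
      unfolding 0 by (simp add: k0 bounded_ops_zero_arg[OF T] del: zero_fun_apply)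
    with d show ?thesis by simp
  next
    case (Suc j)
    have "nrm (ell r) (proj (block i) (T (proj {..<k (i - 1)} x))) \<le>
        nrm (ell r) (proj {k (Suc j)..} (T (proj {..<k j} x)))"
      unfolding Suc using T x pos
      by (auto intro!: nrm_proj_mono bounded_ops_mem[OF T] proj_mem simp: block_def)
    also have "\<dots> \<le> d / 2 ^ j * nrm (ell p) x" by (rule below[OF x])
    finally show ?thesis using Suc by simp
  qed
  moreover have "nrm (ell r) (proj (block i) (T (proj {k (i + 2)..} x))) \<le> d / 2 ^ i * nrm (ell p) x"
  proof -
    have "nrm (ell r) (proj (block i) (T (proj {k (i + 2)..} x))) \<le>
        nrm (ell r) (proj {..<k (Suc i)} (T (proj {k (Suc (Suc i))..} x)))"
      using x pos by (auto intro!: nrm_proj_mono bounded_ops_mem[OF T] proj_mem simp: block_def)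
    also have "\<dots> \<le> d / 2 ^ Suc i * nrm (ell p) x" by (rule above[OF x])
    also have "\<dots> \<le> d / 2 ^ i * nrm (ell p) x" by (rule decay_Suc) simp
    finally show ?thesis .
  qed
  ultimately show ?thesis unfolding mult.assoc by (rule le_three_times)
qed

text \<open>
  The transposed estimate: now the image is cut to the complement of the window.
\<close>

lemma block_column_outside_window:
  assumes x: "x \<in> vecs (ell p)"
  shows "nrm (ell r) (proj (- window i) (T (proj (block i) x))) \<le> 3 * (d / 2 ^ i) * nrm (ell p) x"
proof -
  define y where "y = proj (block i) x"
  have y: "y \<in> vecs (ell p)" and ny: "nrm (ell p) y \<le> nrm (ell p) x"
    using x pos by (auto simp: y_def proj_mem nrm_proj_le)
  have Ty: "T y \<in> vecs (ell r)" by (rule bounded_ops_mem[OF T y])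
  have "nrm (ell r) (proj (- window i) (T y)) \<le>
      nrm (ell r) (proj {..<k (i - 1)} (T y)) + nrm (ell r) (proj {k (i + 2)..} (T y))"
    unfolding compl_window(1) proj_Un[OF compl_window(2)]
    by (intro R.nrm_triangle proj_mem pos Ty)
  moreover have "nrm (ell r) (proj {..<k (i - 1)} (T y)) \<le> 2 * (d / 2 ^ i) * nrm (ell p) y"
  proof (cases i)
    case 0
    with d show ?thesis by (simp add: k0 del: zero_fun_apply)
  next
    case (Suc j)
    have "proj {k (Suc j)..} y = y"
      by (auto simp: y_def Suc block_def proj_def fun_eq_iff)
    with above[OF y, of j] show ?thesis using Suc by simp
  qed
  moreover have "nrm (ell r) (proj {k (i + 2)..} (T y)) \<le> d / 2 ^ i * nrm (ell p) y"
  proof -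
    have "proj {..<k (Suc i)} y = y" by (auto simp: y_def block_def proj_def fun_eq_iff)
    then have "nrm (ell r) (proj {k (i + 2)..} (T y)) \<le> d / 2 ^ Suc i * nrm (ell p) y"
      using below[OF y, of "Suc i"] by simp
    also have "\<dots> \<le> d / 2 ^ i * nrm (ell p) y" by (rule decay_Suc) simp
    finally show ?thesis .
  qed
  ultimately have "nrm (ell r) (proj (- window i) (T y)) \<le> 3 * (d / 2 ^ i) * nrm (ell p) y"
    unfolding mult.assoc by (rule le_three_times)
  also have "\<dots> \<le> 3 * (d / 2 ^ i) * nrm (ell p) x" using d ny by (intro mult_left_mono) auto
  finally show ?thesis by (simp add: y_def)
qed

end

text \<open>
  Given \<open>k i\<close>, each of the four conditions on \<open>k (Suc i)\<close> holds for all large values, so they can be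
  met together and \<open>k\<close> is chosen recursively.
\<close>

lemma common_blocking:
  fixes A B :: "(nat \<Rightarrow> 'k::real_normed_field) \<Rightarrow> (nat \<Rightarrow> 'k)"
  assumes "1 < p" "1 < s" "1 \<le> q" and B: "B \<in> bounded_ops (ell p) (ell s)"
    and A: "A \<in> bounded_ops (ell s) (ell q)" and d: "0 < d"
  obtains k where "almost_banded k p s d B" "almost_banded k s q d A"
proof -
  define good where "good = (\<lambda>n j m.
    (\<forall>x\<in>vecs (ell p). nrm (ell s) (proj {m..} (B (proj {..<j} x))) \<le> d / 2 ^ n * nrm (ell p) x) \<and>
    (\<forall>x\<in>vecs (ell p). nrm (ell s) (proj {..<j} (B (proj {m..} x))) \<le> d / 2 ^ n * nrm (ell p) x) \<and>
    (\<forall>x\<in>vecs (ell s). nrm (ell q) (proj {m..} (A (proj {..<j} x))) \<le> d / 2 ^ n * nrm (ell s) x) \<and>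
    (\<forall>x\<in>vecs (ell s). nrm (ell q) (proj {..<j} (A (proj {m..} x))) \<le> d / 2 ^ n * nrm (ell s) x))"
  have step: "\<exists>m. (Suc n = 0 \<longrightarrow> m = 0) \<and> j < m \<and> good n j m" for n j
  proof -
    have "0 < d / 2 ^ n" using d by simp
    then have "\<forall>\<^sub>F m in sequentially. good n j m"
      unfolding good_def using assms
      by (intro eventually_conj rows_almost_finite columns_almost_finite) auto
    with eventually_gt_at_top[of j] have "\<forall>\<^sub>F m in sequentially. j < m \<and> good n j m"
      by eventually_elim simp
    then show ?thesis by (auto simp: eventually_sequentially)
  qed
  have "\<exists>k. \<forall>n. (n = 0 \<longrightarrow> k n = 0) \<and> (k n < k (Suc n) \<and> good n (k n) (k (Suc n)))"
    by (rule dependent_nat_choice) (use step in auto)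
  then obtain k where k: "k 0 = 0" "\<And>n. k n < k (Suc n)" "\<And>n. good n (k n) (k (Suc n))"
    by blast
  have "blocking k" using k by unfold_locales (auto intro: strict_monoI_Suc)
  with k(3) assms show ?thesis
    by (intro that; unfold almost_banded_def almost_banded_axioms_def good_def) auto
qed

text \<open>
  The operator \<open>V \<circ> formal_identity p \<circ> U\<close> is the block sum of the operators \<open>W\<^sub>i A Q\<^sub>i B W\<^sub>i\<close>. It
  differs from the sum of the \<open>A Q\<^sub>i B\<close> by the terms \<open>W\<^sub>i A Q\<^sub>i B (1 - W\<^sub>i)\<close> and
  \<open>(1 - W\<^sub>i) A Q\<^sub>i B\<close>, both of which only involve entries outside the band of \<open>B\<close> or of \<open>A\<close>.
\<close>

lemma product_approx_block_sum:
  fixes A B :: "(nat \<Rightarrow> 'k::real_normed_field) \<Rightarrow> (nat \<Rightarrow> 'k)"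
  assumes p: "1 < p" and pq: "p \<le> q" and e: "0 < e"
    and B: "B \<in> bounded_ops (ell p) (ell 2)" and A: "A \<in> bounded_ops (ell 2) (ell q)"
  shows "\<exists>U\<in>bounded_ops (ell p) (ell2_sum p). \<exists>V\<in>bounded_ops (ell2_sum q) (ell q).
    \<forall>x\<in>vecs (ell p). nrm (ell q) (A (B x) - V (formal_identity p (U x))) \<le> e * nrm (ell p) x"
proof -
  have q: "1 \<le> q" and pos: "0 < p" "0 < q" "0 < (2::real)" using p pq by auto
  interpret P: normed_carrier "ell p :: (nat, 'k) nspace" using p by (intro normed_carrier_ell) simp
  interpret Q: normed_carrier "ell q :: (nat, 'k) nspace" by (rule normed_carrier_ell[OF q])
  interpret H: normed_carrier "ell 2 :: (nat, 'k) nspace" by (rule normed_carrier_ell) simp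
  obtain CB where CB: "CB > 0" "\<And>x. x \<in> vecs (ell p) \<Longrightarrow> nrm (ell 2) (B x) \<le> CB * nrm (ell p) x"
    using bounded_ops_bound[OF B] nrm_ell_nonneg by blast
  obtain CA where CA: "CA > 0" "\<And>x. x \<in> vecs (ell 2) \<Longrightarrow> nrm (ell q) (A x) \<le> CA * nrm (ell 2) x"
    using bounded_ops_bound[OF A] nrm_ell_nonneg by blast
  \<comment> \<open>The \<open>i\<close>-th error will be at most \<open>3 * (CA + CB) * (d / 2 ^ i)\<close>, and the geometric series
    contributes a factor \<open>2\<close>.\<close>
  define d where "d = e / (6 * (CA + CB))"
  have d: "0 < d" using e CA CB by (simp add: d_def)
  obtain k where k: "almost_banded k p 2 d B" "almost_banded k 2 q d A"
    using common_blocking[OF p _ q B A d] by auto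
  interpret B: almost_banded k p 2 d B by (rule k)
  interpret A: almost_banded k 2 q d A by (rule k)
  \<comment> \<open>\<open>G i\<close> is \<open>Q\<^sub>i B W\<^sub>i\<close> and \<open>L i\<close> is \<open>W\<^sub>i A Q\<^sub>i\<close>.\<close>
  define G where "G = (\<lambda>i x. proj (B.block i) (B (proj (B.window i) x)))"
  define L where "L = (\<lambda>i y. proj (B.window i) (A (proj (B.block i) y)))"
  have G_mem: "G i x \<in> vecs (ell 2)" if "x \<in> vecs (ell p)" for i x
    unfolding G_def by (intro proj_mem bounded_ops_mem[OF B] pos that)
  have L_mem: "L i y \<in> vecs (ell q)" if "y \<in> vecs (ell 2)" for i y
    unfolding L_def by (intro proj_mem bounded_ops_mem[OF A] pos that)
  have G_add: "G i (x + y) = G i x + G i y" if "x \<in> vecs (ell p)" "y \<in> vecs (ell p)" for i x y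
    unfolding G_def proj_add
    by (subst bounded_ops_add[OF B]) (simp_all only: proj_add proj_mem pos that)
  have L_add: "L i (x + y) = L i x + L i y" if "x \<in> vecs (ell 2)" "y \<in> vecs (ell 2)" for i x y
    unfolding L_def proj_add
    by (subst bounded_ops_add[OF A]) (simp_all only: proj_add proj_mem pos that)
  have G_scl: "G i (scl c x) = scl c (G i x)" if "x \<in> vecs (ell p)" for i c x
    unfolding G_def proj_scl
    by (subst bounded_ops_scl[OF B]) (simp_all only: proj_scl proj_mem pos that)
  have L_scl: "L i (scl c x) = scl c (L i x)" if "x \<in> vecs (ell 2)" for i c x
    unfolding L_def proj_scl
    by (subst bounded_ops_scl[OF A]) (simp_all only: proj_scl proj_mem pos that)
  define U where "U = on_carrier (ell p) (\<lambda>x. B.embed (\<lambda>i. G i x))"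
  define V where "V = on_carrier (ell2_sum q)
    (\<lambda>y n. \<Sum>i | n \<in> B.window i. L i (slice y (B.slot i)) n)"
  have U_bound: "B.embed (\<lambda>i. G i x) \<in> vecs (ell2_sum p)"
    "nrm (ell2_sum p) (B.embed (\<lambda>i. G i x)) \<le> (CB * 3 powr (1 / p)) * nrm (ell p) x"
    if x: "x \<in> vecs (ell p)" for x
  proof -
    let ?c = "(CB * 3 powr (1 / p)) * nrm (ell p) x"
    have supp: "G i x l = 0" if "B.slot i < l" for i l
      using that by (auto simp: G_def proj_def B.block_def B.slot_def)
    have "(\<Sum>i<N. nrm (ell 2) (G i x) powr p) \<le> ?c powr p" for N
    proof -
      have "nrm (ell 2) (G i x) \<le> CB * nrm (ell p) (proj (B.window i) x)" for i
      proof -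
        have "nrm (ell 2) (G i x) \<le> nrm (ell 2) (B (proj (B.window i) x))"
          unfolding G_def by (intro nrm_proj_le bounded_ops_mem[OF B] proj_mem pos x)
        also have "\<dots> \<le> CB * nrm (ell p) (proj (B.window i) x)" by (intro CB proj_mem pos x)
        finally show ?thesis .
      qed
      then have "(\<Sum>i<N. nrm (ell 2) (G i x) powr p) \<le>
          (\<Sum>i<N. (CB * nrm (ell p) (proj (B.window i) x)) powr p)"
        using pos by (intro sum_mono powr_mono2) auto
      also have "\<dots> = CB powr p * (\<Sum>i<N. nrm (ell p) (proj (B.window i) x) powr p)"
        by (simp add: powr_mult sum_distrib_left)
      also have "\<dots> \<le> CB powr p * (3 * nrm (ell p) x powr p)"
        by (intro mult_left_mono B.sum_window_powr_le pos x) simp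
      also have "\<dots> = ?c powr p" using pos by (simp add: powr_mult powr_powr)
      finally show ?thesis .
    qed
    note b = B.embed_bound[OF pos(1) _ supp this]
    show "B.embed (\<lambda>i. G i x) \<in> vecs (ell2_sum p)" by (rule b(1)) (use CB in auto)
    show "nrm (ell2_sum p) (B.embed (\<lambda>i. G i x)) \<le> ?c" by (rule b(2)) (use CB in auto)
  qed
  have U: "U \<in> bounded_ops (ell p) (ell2_sum p)"
    unfolding U_def
  proof (rule on_carrier_bounded_ops[OF P.normed_carrier_axioms U_bound(1) _ _ U_bound(2)])
    fix x y :: "nat \<Rightarrow> 'k" assume x: "x \<in> vecs (ell p)"
    show "B.embed (\<lambda>i. G i (scl c x)) = scl c (B.embed (\<lambda>i. G i x))" for c
      unfolding G_scl[OF x] by (auto simp: B.embed_def scl_def fun_eq_iff)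
    assume y: "y \<in> vecs (ell p)"
    show "B.embed (\<lambda>i. G i (x + y)) = B.embed (\<lambda>i. G i x) + B.embed (\<lambda>i. G i y)"
      unfolding G_add[OF x y] by (auto simp: B.embed_def fun_eq_iff)
  qed
  have V: "V \<in> bounded_ops (ell2_sum q) (ell q)"
    unfolding V_def
  proof (rule on_carrier_bounded_ops[where C = "3 * CA"])
    show "normed_carrier (ell2_sum q :: (nat \<times> nat, 'k) nspace)" by (rule normed_carrier_ell2_sum[OF q])
    fix y z :: "nat \<times> nat \<Rightarrow> 'k" assume y: "y \<in> vecs (ell2_sum q)"
    note y' = ell2_sum_dest[OF y]
    have sy: "slice y n \<in> vecs (ell 2)" for n by (rule y') simp
    have L_le: "nrm (ell q) (L i (slice y s)) \<le> CA * slice_norms y s" for i s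
    proof -
      have "nrm (ell q) (L i (slice y s)) \<le> nrm (ell q) (A (proj (B.block i) (slice y s)))"
        unfolding L_def by (intro nrm_proj_le bounded_ops_mem[OF A] proj_mem pos sy)
      also have "\<dots> \<le> CA * nrm (ell 2) (proj (B.block i) (slice y s))"
        by (intro CA proj_mem pos sy)
      also have "\<dots> \<le> CA * slice_norms y s"
        unfolding slice_norms_def using CA by (intro mult_left_mono nrm_proj_le pos sy) auto
      finally show ?thesis .
    qed
    have "(\<Sum>i<N. nrm (ell q) (L i (slice y (B.slot i))) powr q) \<le>
        (CA * nrm (ell2_sum q) y) powr q" for N
    proof -
      have "(\<Sum>i<N. nrm (ell q) (L i (slice y (B.slot i))) powr q) \<le>
          (\<Sum>i<N. (CA * slice_norms y (B.slot i)) powr q)"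
        using pos by (intro sum_mono powr_mono2 L_le) auto
      also have "\<dots> = CA powr q * (\<Sum>s\<in>B.slot ` {..<N}. norm (slice_norms y s) powr q)"
        using B.inj_slot by (subst sum.reindex)
          (auto intro: inj_on_subset simp: powr_mult sum_distrib_left)
      also have "\<dots> \<le> CA powr q * nrm (ell2_sum q) y powr q"
        unfolding y'(3) by (intro mult_left_mono ell_sum_le pos y'(2)) auto
      finally show ?thesis by (simp add: powr_mult)
    qed
    note b = B.window_sum_bound[where u = "\<lambda>i. L i (slice y (B.slot i))", OF pos(2) _ L_mem[OF sy] this]
    show "(\<lambda>n. \<Sum>i | n \<in> B.window i. L i (slice y (B.slot i)) n) \<in> vecs (ell q)"
      by (rule b(1)) (use CA in auto)
    have "nrm (ell q) (\<lambda>n. \<Sum>i | n \<in> B.window i. L i (slice y (B.slot i)) n) \<le>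
        3 * (CA * nrm (ell2_sum q) y)"
      by (rule b(2)) (use CA in auto)
    then show "nrm (ell q) (\<lambda>n. \<Sum>i | n \<in> B.window i. L i (slice y (B.slot i)) n) \<le>
        3 * CA * nrm (ell2_sum q) y" by simp
    show "(\<lambda>n. \<Sum>i | n \<in> B.window i. L i (slice (scl c y) (B.slot i)) n) =
        scl c (\<lambda>n. \<Sum>i | n \<in> B.window i. L i (slice y (B.slot i)) n)" for c
      unfolding slice_scl L_scl[OF sy] by (simp add: scl_def sum_distrib_left)
    assume z: "z \<in> vecs (ell2_sum q)"
    have sz: "slice z n \<in> vecs (ell 2)" for n by (rule ell2_sum_dest(4)[OF z]) simp
    show "(\<lambda>n. \<Sum>i | n \<in> B.window i. L i (slice (y + z) (B.slot i)) n) =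
        (\<lambda>n. \<Sum>i | n \<in> B.window i. L i (slice y (B.slot i)) n) +
        (\<lambda>n. \<Sum>i | n \<in> B.window i. L i (slice z (B.slot i)) n)"
      unfolding slice_add L_add[OF sy sz] by (simp add: sum.distrib fun_eq_iff)
  qed
  have "nrm (ell q) (A (B x) - V (formal_identity p (U x))) \<le> e * nrm (ell p) x"
    if x: "x \<in> vecs (ell p)" for x
  proof -
    have Bx: "B x \<in> vecs (ell 2)" by (rule bounded_ops_mem[OF B x])
    have Ux: "U x \<in> vecs (ell2_sum p)" "U x \<in> vecs (ell2_sum q)"
      using bounded_ops_mem[OF U x] ell2_sum_mono_exponent(1)[OF pos(1) pq] by auto
    have VUx: "V (formal_identity p (U x)) \<in> vecs (ell q)"
      using bounded_ops_mem[OF V Ux(2)] Ux(1) by (simp add: formal_identity_def)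
    define S' where "S' = V (formal_identity p (U x))"
    have S': "S' n = (\<Sum>i | n \<in> B.window i. L i (G i x) n)" for n
      using Ux x by (simp add: S'_def formal_identity_def V_def on_carrier_def)
        (simp add: U_def on_carrier_def B.slice_embed)
    define D where "D = (\<lambda>i. A (proj (B.block i) (B x)) - L i (G i x))"
    have D_mem: "D i \<in> vecs (ell q)" for i
      unfolding D_def by (intro Q.diff_mem bounded_ops_mem[OF A] proj_mem pos Bx L_mem G_mem x)
    have D_le: "nrm (ell q) (D i) \<le> 3 * (CA + CB) * (d / 2 ^ i) * nrm (ell p) x" for i
    proof -
      define y where "y = B (proj (- B.window i) x)"
      have y: "y \<in> vecs (ell 2)" unfolding y_def by (intro bounded_ops_mem[OF B] proj_mem pos x)
      have split: "proj (B.window i) z + proj (- B.window i) z = z" for z :: "nat \<Rightarrow> 'k"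
        by (auto simp: proj_def fun_eq_iff)
      have "B x = B (proj (B.window i) x) + y"
        using bounded_ops_add[OF B proj_mem[OF pos(1) x] proj_mem[OF pos(1) x],
            of "B.window i" "- B.window i"]
        by (simp only: split y_def)
      then have "proj (B.block i) (B x) = G i x + proj (B.block i) y"
        by (simp only: proj_add G_def)
      moreover have "proj (B.block i) (G i x) = G i x" by (simp add: G_def proj_proj)
      ultimately have "L i (B x) = L i (G i x) + L i y"
      proof -
        assume eq: "proj (B.block i) (B x) = G i x + proj (B.block i) y"
          and idem: "proj (B.block i) (G i x) = G i x"
        have "A (proj (B.block i) (B x)) = A (G i x) + A (proj (B.block i) y)"
          unfolding eq by (intro bounded_ops_add[OF A] G_mem proj_mem pos x y)
        then show ?thesis unfolding L_def idem by (simp only: proj_add)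
      qed
      moreover have "A (proj (B.block i) (B x)) =
          L i (B x) + proj (- B.window i) (A (proj (B.block i) (B x)))"
        unfolding L_def split ..
      ultimately have D: "D i = L i y + proj (- B.window i) (A (proj (B.block i) (B x)))"
        unfolding D_def by (simp add: algebra_simps del: plus_fun_apply)
      have 1: "nrm (ell q) (L i y) \<le> CA * (3 * (d / 2 ^ i) * nrm (ell p) x)"
      proof -
        have "nrm (ell q) (L i y) \<le> nrm (ell q) (A (proj (B.block i) y))"
          unfolding L_def by (intro nrm_proj_le bounded_ops_mem[OF A] proj_mem pos y)
        also have "\<dots> \<le> CA * nrm (ell 2) (proj (B.block i) y)" by (intro CA proj_mem pos y)
        also have "\<dots> \<le> CA * (3 * (d / 2 ^ i) * nrm (ell p) x)"
          unfolding y_def using CA by (intro mult_left_mono B.block_row_outside_window x) simp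
        finally show ?thesis .
      qed
      have 2: "nrm (ell q) (proj (- B.window i) (A (proj (B.block i) (B x)))) \<le>
          3 * (d / 2 ^ i) * (CB * nrm (ell p) x)"
      proof -
        have "nrm (ell q) (proj (- B.window i) (A (proj (B.block i) (B x)))) \<le>
            3 * (d / 2 ^ i) * nrm (ell 2) (B x)"
          by (rule A.block_column_outside_window[OF Bx])
        also have "\<dots> \<le> 3 * (d / 2 ^ i) * (CB * nrm (ell p) x)"
          using d by (intro mult_left_mono CB x) auto
        finally show ?thesis .
      qed
      have "nrm (ell q) (D i) \<le>
          nrm (ell q) (L i y) + nrm (ell q) (proj (- B.window i) (A (proj (B.block i) (B x))))"
        unfolding D
        by (intro Q.nrm_triangle L_mem proj_mem bounded_ops_mem[OF A] pos y Bx)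
      with 1 2 show ?thesis by (simp add: algebra_simps)
    qed
    have sum_D: "nrm (ell q) (\<Sum>i<N. D i) \<le> e * nrm (ell p) x" for N
    proof -
      have geometric: "(\<Sum>i<N. 1 / 2 ^ i) \<le> (2::real)"
        using sum_le_suminf[of "\<lambda>i. (1 / 2 :: real) ^ i" "{..<N}"] suminf_geometric[of "1 / 2 :: real"]
          summable_geometric[of "1 / 2 :: real"]
        by (simp add: power_one_over)
      have "nrm (ell q) (\<Sum>i<N. D i) \<le> (\<Sum>i<N. nrm (ell q) (D i))"
        by (rule Q.nrm_sum_le) (rule D_mem)
      also have "\<dots> \<le> (\<Sum>i<N. 3 * (CA + CB) * (d / 2 ^ i) * nrm (ell p) x)"
        by (intro sum_mono D_le)
      also have "\<dots> = 3 * (CA + CB) * d * nrm (ell p) x * (\<Sum>i<N. 1 / 2 ^ i)"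
        by (simp add: sum_distrib_left mult_ac)
      also have "\<dots> \<le> 3 * (CA + CB) * d * nrm (ell p) x * 2"
        using CA CB d geometric by (intro mult_left_mono) auto
      also have "\<dots> = 6 * (CA + CB) * d * nrm (ell p) x" by simp
      also have "6 * (CA + CB) * d = e" using CA(1) CB(1) by (simp add: d_def)
      finally show ?thesis .
    qed
    \<comment> \<open>On finitely many coordinates the block sum is a finite sum, so there the difference is a
      partial sum of the errors \<open>D i\<close> up to the image \<open>R\<close> of a tail of \<open>B x\<close>, which can be made
      arbitrarily small.\<close>
    have truncation_le: "nrm (ell q) (proj {..<M} (A (B x) - S')) \<le> e * nrm (ell p) x" for M
    proof (rule field_le_epsilon)
      fix t :: real assume t: "0 < t"
      then have "0 < t / CA" using CA by simp
      from nrm_tail_small[OF pos(3) Bx this] obtain m where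
        m: "\<And>n. m \<le> n \<Longrightarrow> nrm (ell 2) (proj {n..} (B x)) \<le> t / CA"
        unfolding eventually_sequentially by blast
      define N where "N = max m (M + 1)"
      have "m \<le> k N" using B.le_k[of N] by (simp add: N_def)
      define R where "R = A (proj {k N..} (B x))"
      have R_mem: "R \<in> vecs (ell q)"
        unfolding R_def by (intro bounded_ops_mem[OF A] proj_mem pos Bx)
      have R_le: "nrm (ell q) R \<le> t"
      proof -
        have "nrm (ell q) R \<le> CA * nrm (ell 2) (proj {k N..} (B x))"
          unfolding R_def by (intro CA proj_mem pos Bx)
        also have "\<dots> \<le> CA * (t / CA)" using CA m[OF \<open>m \<le> k N\<close>] by (intro mult_left_mono) auto
        finally show ?thesis using CA by simp
      qed
      have ABx: "A (B x) = (\<Sum>i<N. A (proj (B.block i) (B x))) + R"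
      proof -
        have A_sum: "A (\<Sum>i<j. proj (B.block i) (B x)) = (\<Sum>i<j. A (proj (B.block i) (B x)))" for j
        proof (induction j)
          case 0
          show ?case by (simp add: bounded_ops_zero_arg[OF A] del: zero_fun_apply)
        next
          case (Suc j)
          have mem: "(\<Sum>i<j. proj (B.block i) (B x)) \<in> vecs (ell 2)"
            by (intro H.sum_mem proj_mem pos Bx)
          show ?case
            unfolding sum.lessThan_Suc bounded_ops_add[OF A mem proj_mem[OF pos(3) Bx]] Suc.IH ..
        qed
        have "A (B x) = A ((\<Sum>i<N. proj (B.block i) (B x)) + proj {k N..} (B x))"
          using B.split_sum_blocks[of "B x" N] by (rule arg_cong)
        also have "\<dots> = A (\<Sum>i<N. proj (B.block i) (B x)) + R"
          unfolding R_def by (intro bounded_ops_add[OF A] H.sum_mem proj_mem pos Bx)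
        finally show ?thesis unfolding A_sum .
      qed
      have "proj {..<M} (A (B x) - S') = proj {..<M} ((\<Sum>i<N. D i) + R)"
      proof (rule proj_cong)
        fix n assume "n \<in> {..<M}"
        then have "S' n = (\<Sum>i<N. L i (G i x) n)"
          unfolding S'
          by (intro sum.mono_neutral_left)
            (auto simp: N_def L_def proj_apply dest: B.window_index_le)
        moreover have "A (B x) n = (\<Sum>i<N. A (proj (B.block i) (B x)) n) + R n"
          by (subst ABx) (simp only: plus_fun_apply sum_fun_eval)
        ultimately show "(A (B x) - S') n = ((\<Sum>i<N. D i) + R) n"
          by (simp add: D_def sum_subtractf sum_fun_eval)
      qed
      then have "nrm (ell q) (proj {..<M} (A (B x) - S')) \<le> nrm (ell q) ((\<Sum>i<N. D i) + R)"
        by (simp only:) (intro nrm_proj_le pos Q.add_mem Q.sum_mem D_mem R_mem)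
      also have "\<dots> \<le> nrm (ell q) (\<Sum>i<N. D i) + nrm (ell q) R"
        by (intro Q.nrm_triangle Q.sum_mem R_mem D_mem)
      also have "\<dots> \<le> e * nrm (ell p) x + t" by (intro add_mono sum_D R_le)
      finally show "nrm (ell q) (proj {..<M} (A (B x) - S')) \<le> e * nrm (ell p) x + t" .
    qed
    have "A (B x) - S' \<in> vecs (ell q)"
      unfolding S'_def by (intro Q.diff_mem VUx bounded_ops_mem[OF A] Bx)
    moreover have "0 \<le> e * nrm (ell p) x" using e by simp
    ultimately have "nrm (ell q) (A (B x) - S') \<le> e * nrm (ell p) x"
      by (rule nrm_le_if_truncations_le[OF pos(2) _ _ truncation_le])
    then show ?thesis unfolding S'_def .
  qed
  then have approx: "\<forall>x\<in>vecs (ell p). nrm (ell q) (A (B x) - V (formal_identity p (U x))) \<le> e * nrm (ell p) x"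
    by (rule ballI)
  show ?thesis
    by (rule bexI[OF _ U], rule bexI[OF _ V], rule approx)
qed

section \<open>The closed ideal generated by a decomposition operator\<close>

theorem theorem4p6:
  fixes p q :: real
    and T :: "(nat \<Rightarrow> 'k::{real_normed_field, banach}) \<Rightarrow> (nat \<Rightarrow> 'k)"
  assumes "1 < p" "p \<le> 2" "2 \<le> q" "p < q"
    and "Pelczynski_decomposition_op p q T"
  shows "generated_closed_ideal (ell p) (ell q) T =
         op_closure (ell p) (ell q) {S \<in> bounded_ops (ell p) (ell q). factors_through_ell2 (ell p) (ell q) S}"
    (is "_ = op_closure ?X ?Y ?F")
proof -
  have X: "normed_carrier ?X" and Y: "normed_carrier ?Y"
    using assms by (auto intro: normed_carrier_ell)
  have ideal: "closed_op_ideal ?X ?Y (op_closure ?X ?Y ?F)"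
    by (intro closed_op_ideal_op_closure op_ideal_factors_through_ell2 X Y)
  obtain U V where U: "isomorphism ?X (ell2_sum p) U" and V: "isomorphism (ell2_sum q) ?Y V"
    and T: "T = V \<circ> formal_identity p \<circ> U"
    using assms(5) unfolding Pelczynski_decomposition_op_def by blast
  have U': "U \<in> bounded_ops ?X (ell2_sum p)" and V': "V \<in> bounded_ops (ell2_sum q) ?Y"
    using U V by (auto simp: isomorphism_def)
  obtain U1 where U1: "U1 \<in> bounded_ops (ell2_sum p) ?X" "\<And>y. y \<in> vecs (ell2_sum p) \<Longrightarrow> U (U1 y) = y"
    using U unfolding isomorphism_def by blast
  obtain V1 where V1: "V1 \<in> bounded_ops ?Y (ell2_sum q)" "\<And>y. y \<in> vecs (ell2_sum q) \<Longrightarrow> V1 (V y) = y"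
    using V unfolding isomorphism_def by blast
  have I: "formal_identity p \<in> bounded_ops (ell2_sum p) (ell2_sum q)"
    using assms by (intro formal_identity_bounded_ops) auto
  have "T \<in> ?F"
  proof -
    obtain E F where EF: "E \<in> bounded_ops (ell2_sum p) (ell 2)" "F \<in> bounded_ops (ell 2) (ell2_sum q)"
      "formal_identity p = F \<circ> (E :: _ \<Rightarrow> nat \<Rightarrow> 'k)"
      using formal_identity_factors_through_ell2[of p q] assms by auto
    have "E \<circ> U \<in> bounded_ops ?X (ell 2)" "V \<circ> F \<in> bounded_ops (ell 2) ?Y"
      by (intro bounded_ops_comp[OF U' EF(1)] bounded_ops_comp[OF EF(2) V']; simp)+
    moreover from this have "(V \<circ> F) \<circ> (E \<circ> U) \<in> bounded_ops ?X ?Y"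
      by (intro bounded_ops_comp[where Y = "ell 2"]) auto
    moreover have "T = (V \<circ> F) \<circ> (E \<circ> U)" by (simp add: T EF(3) comp_assoc)
    ultimately show ?thesis unfolding factors_through_ell2_def by auto
  qed
  moreover have "?F \<subseteq> op_closure ?X ?Y ?F"
  proof
    fix S assume S: "S \<in> ?F"
    have "op_norm ?X ?Y (S - S) < e" if "0 < e" for e :: real
    proof -
      have "op_norm ?X ?Y (S - S) \<le> 0"
      proof (rule op_norm_le[OF X])
        fix x
        have "(S - S) x = 0" by simp
        then show "nrm ?Y ((S - S) x) \<le> 0 * nrm ?X x"
          by (simp only: normed_carrier.nrm_zero[OF Y])
      qed simp
      with that show ?thesis by simp
    qed
    with S show "S \<in> op_closure ?X ?Y ?F" unfolding op_closure_def by blast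
  qed
  ultimately have upper: "generated_closed_ideal ?X ?Y T \<subseteq> op_closure ?X ?Y ?F"
    using ideal unfolding generated_closed_ideal_def by blast
  have lower: "op_closure ?X ?Y ?F \<subseteq> J" if J: "closed_op_ideal ?X ?Y J" and TJ: "T \<in> J" for J
  proof -
    have sub: "J \<subseteq> bounded_ops ?X ?Y" and cl: "op_closure ?X ?Y J = J"
      using J by (auto simp: closed_op_ideal_def op_ideal_def)
    have "S \<in> J" if S: "S \<in> ?F" for S
    proof -
      obtain A B where AB: "B \<in> bounded_ops ?X (ell 2)" "A \<in> bounded_ops (ell 2) ?Y" "S = A \<circ> B"
        using S unfolding factors_through_ell2_def by blast
      have "\<exists>R\<in>J. \<forall>x\<in>vecs ?X. nrm ?Y (S x - R x) \<le> e * nrm ?X x" if e: "0 < e" for e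
      proof -
        have "p \<le> q" using assms by simp
        from product_approx_block_sum[OF assms(1) this e AB(1,2)] obtain U0 V0 where
          U0: "U0 \<in> bounded_ops ?X (ell2_sum p)" and V0: "V0 \<in> bounded_ops (ell2_sum q) ?Y" and
          approx: "\<And>x. x \<in> vecs ?X \<Longrightarrow>
            nrm ?Y (A (B x) - V0 (formal_identity p (U0 x))) \<le> e * nrm ?X x"
          by blast
        \<comment> \<open>Undoing the isomorphisms in \<open>T\<close> exposes the formal identity, up to multiplication by
          operators on \<open>ell q\<close> and \<open>ell p\<close>.\<close>
        have "V0 \<circ> V1 \<in> bounded_ops ?Y ?Y" "U1 \<circ> U0 \<in> bounded_ops ?X ?X"
          by (intro bounded_ops_comp[OF V1(1) V0] bounded_ops_comp[OF U0 U1(1)]; simp)+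
        then have "(V0 \<circ> V1) \<circ> T \<circ> (U1 \<circ> U0) \<in> J"
          using J TJ by (simp add: closed_op_ideal_def op_ideal_def)
        moreover have "((V0 \<circ> V1) \<circ> T \<circ> (U1 \<circ> U0)) x = V0 (formal_identity p (U0 x))"
          if "x \<in> vecs ?X" for x
        proof -
          have "U0 x \<in> vecs (ell2_sum p)" by (rule bounded_ops_mem[OF U0 that])
          moreover from this have "formal_identity p (U0 x) \<in> vecs (ell2_sum q)"
            by (rule bounded_ops_mem[OF I])
          ultimately show ?thesis by (simp add: T U1(2) V1(2))
        qed
        ultimately show ?thesis
          using approx by (intro bexI[of _ "(V0 \<circ> V1) \<circ> T \<circ> (U1 \<circ> U0)"]) (auto simp: AB(3))
      qed
      with S have "S \<in> op_closure ?X ?Y J" unfolding op_closure_iff[OF X Y sub] by blast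
      then show ?thesis by (simp add: cl)
    qed
    then have "op_closure ?X ?Y ?F \<subseteq> op_closure ?X ?Y J" unfolding op_closure_def by blast
    then show ?thesis by (simp add: cl)
  qed
  have "op_closure ?X ?Y ?F \<subseteq> generated_closed_ideal ?X ?Y T"
    unfolding generated_closed_ideal_def
  proof (rule Inter_greatest)
    fix J assume "J \<in> {J. closed_op_ideal ?X ?Y J \<and> T \<in> J}"
    then have "closed_op_ideal ?X ?Y J" "T \<in> J" by simp_all
    then show "op_closure ?X ?Y ?F \<subseteq> J" by (rule lower)
  qed
  with upper show ?thesis by (rule equalityI)
qed

end
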